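(* Let $G:\mathbb{R}^n\to\mathbb{S}^m$ be continuously differentiable and let $\bar x\in\mathcal{F}$. If seq-CPLD holds at $\bar x$ and $G$ is twice differentiable around $\bar x$, then $\bar x$ satisfies the metric subregularity CQ.
   Context: $\mathbb{S}^m$ is the space of real symmetric $m\times m$ matrices with the Frobenius norm; $\mathbb{S}^m_+$ is the cone of positive semidefinite matrices; $M\succeq 0$ means $M\in\mathbb{S}^m_+$; $\Pi_{\mathbb{S}^m_+}$ is the orthogonal projection onto $\mathbb{S}^m_+$. $\mathcal{F}=\{x\in\mathbb{R}^n: G(x)\succeq 0\}$. $D_{x_i}G(x)$ is the $i$-th partial derivative of $G$. Metric subregularity CQ at $\bar x\in\mathcal{F}$: there exist $\gamma>0$ and a neighborhood $\mathcal{V}$ of $\bar x$ such that $\mathrm{dist}(x,\mathcal{F})\le\gamma\,\|\Pi_{\mathbb{S}^m_+}(-G(x))\|$ for every $x\in\mathcal{V}$, where $\mathrm{dist}$ is the Euclidean distance. Eigenvalues of $M\in\mathbb{S}^m$ are ordered $\lambda_1(M)\ge\dots\ge\lambda_m(M)$. For $0\le r<m$, $\mathcal{E}_r(M)$ is the set of $E\in\mathbb{R}^{m\times(m-r)}$ with $E^\top E=I_{m-r}$ and $ME=E\,\mathrm{Diag}(\lambda_{r+1}(M),\dots,\lambda_m(M))$. For $E$ with columns $e_1,\dots,e_{m-r}$, $v_{ii}(x,E)=[e_i^\top D_{x_1}G(x)e_i,\dots,e_i^\top D_{x_n}G(x)e_i]^\top\in\mathbb{R}^n$. A finite family $\{z_i\}_{i\in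 J}$ is positively linearly dependent if there are $\alpha_i\ge0$, $i \in J$, not all zero, with $\sum_{i\in J}\alpha_iz_i=0$. Seq-CPLD at $\bar x\in\mathcal{F}$, with $r=\mathrm{rank}\,G(\bar x)$: either $r=m$ or, for all sequences $x^k\to\bar x$ and $\{\Delta^k\}\subseteq\mathbb{S}^m$ with $\Delta^k\to0$, there exist an infinite set $I\subseteq\mathbb{N}$ and matrices $E^k\in\mathcal{E}_r(G(x^k)+\Delta^k)$, $k\in I$, with $\{E^k\}_{k\in I}$ convergent to some $\bar E$, such that for every $J\subseteq\{1,\dots,m-r\}$: if $\{v_{ii}(\bar x,\bar E)\}_{i\in J}$ is positively linearly dependent, then $\{v_{ii}(x^k,E^k)\}_{i\in J}$ is linearly dependent for all sufficiently large $k\in I$. *)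

theory Defs
  imports "HOL-Analysis.Analysis" "HOL-Computational_Algebra.Polynomial"
begin

text \<open>
  The norm and inner product of the type \<^typ>\<open>real^'m^'m\<close> are the Frobenius ones.
\<close>

definition symmetric_matrices :: "(real^'m^'m) set" where
  "symmetric_matrices = {M. transpose M = M}"

definition psd_cone :: "(real^'m^'m) set" where
  "psd_cone = {M \<in> symmetric_matrices. \<forall>v. 0 \<le> v \<bullet> (M *v v)}"

definition proj_psd :: "real^'m^'m \<Rightarrow> real^'m^'m" where
  "proj_psd M = closest_point psd_cone M"

definition feasible_set :: "(real^'n \<Rightarrow> real^'m^'m) \<Rightarrow> (real^'n) set" where
  "feasible_set G = {x. G x \<in> psd_cone}"

definition continuously_differentiable ::
  "('a::real_normed_vector \<Rightarrow> 'b::real_normed_vector) \<Rightarrow> bool" where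
  "continuously_differentiable G \<longleftrightarrow>
     (\<exists>G' :: 'a \<Rightarrow> 'a \<Rightarrow>\<^sub>L 'b.
        (\<forall>x. (G has_derivative blinfun_apply (G' x)) (at x)) \<and> continuous_on UNIV G')"

definition twice_differentiable_around ::
  "('a::real_normed_vector \<Rightarrow> 'b::real_normed_vector) \<Rightarrow> 'a \<Rightarrow> bool" where
  "twice_differentiable_around G xbar \<longleftrightarrow>
     (\<exists>U. open U \<and> xbar \<in> U \<and>
        (\<exists>G' :: 'a \<Rightarrow> 'a \<Rightarrow>\<^sub>L 'b.
           \<forall>x\<in>U. (G has_derivative blinfun_apply (G' x)) (at x) \<and> G' differentiable (at x)))"

definition partial_deriv :: "(real^'n \<Rightarrow> real^'m^'m) \<Rightarrow> 'n \<Rightarrow> real^'n \<Rightarrow> real^'m^'m" where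
  "partial_deriv G i x = vector_derivative (\<lambda>t. G (x + t *\<^sub>R axis i 1)) (at 0)"

definition metric_subregularity_CQ :: "(real^'n \<Rightarrow> real^'m^'m) \<Rightarrow> real^'n \<Rightarrow> bool" where
  "metric_subregularity_CQ G xbar \<longleftrightarrow>
     (\<exists>\<gamma>>0. \<exists>V. open V \<and> xbar \<in> V \<and>
        (\<forall>x\<in>V. infdist x (feasible_set G) \<le> \<gamma> * norm (proj_psd (- G x))))"

definition charpoly :: "real^'m^'m \<Rightarrow> real poly" where
  "charpoly M = det (\<chi> i j. (if i = j then [:0, 1:] else 0) - [:M $ i $ j:])"

text \<open>
  \<open>eigval i M\<close> is the \<open>i\<close>-th largest eigenvalue of the symmetric matrix \<open>M\<close>,
  counted with multiplicity, for \<open>1 \<le> i \<le> CARD('m)\<close>.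
\<close>

definition eigval :: "nat \<Rightarrow> real^'m^'m \<Rightarrow> real" where
  "eigval i M = rev (sorted_list_of_multiset (proots (charpoly M))) ! (i - 1)"

text \<open>
  Since the number of columns \<open>CARD('m) - r\<close> varies with \<open>r\<close>, a matrix with
  \<open>CARD('m)\<close> rows and \<open>CARD('m) - r\<close> columns is given by the sequence of its columns
  \<open>E 1, \<dots>, E (CARD('m) - r)\<close>; the values of \<open>E\<close> at other indices are irrelevant.
  The two conditions below are \<open>E\<^sup>T E = I\<close> and
  \<open>M E = E Diag(\<lambda>\<^sub>r\<^sub>+\<^sub>1(M), \<dots>, \<lambda>\<^sub>m(M))\<close>, read columnwise.
\<close>

definition eigvec_matrices :: "nat \<Rightarrow> real^'m^'m \<Rightarrow> (nat \<Rightarrow> real^'m) set" where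
  "eigvec_matrices r M =
     {E. (\<forall>i\<in>{1..CARD('m) - r}. \<forall>j\<in>{1..CARD('m) - r}. E i \<bullet> E j = (if i = j then 1 else 0)) \<and>
         (\<forall>i\<in>{1..CARD('m) - r}. M *v E i = eigval (r + i) M *\<^sub>R E i)}"

definition v_diag ::
  "(real^'n \<Rightarrow> real^'m^'m) \<Rightarrow> real^'n \<Rightarrow> (nat \<Rightarrow> real^'m) \<Rightarrow> nat \<Rightarrow> real^'n" where
  "v_diag G x E i = (\<chi> j. E i \<bullet> (partial_deriv G j x *v E i))"

text \<open>
  Dependence of indexed families: unlike for \<^const>\<open>dependent\<close>, repeated members matter.
\<close>

definition lin_dependent_family :: "'i set \<Rightarrow> ('i \<Rightarrow> 'a::real_vector) \<Rightarrow> bool" where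
  "lin_dependent_family J z \<longleftrightarrow>
     (\<exists>\<alpha>. (\<exists>i\<in>J. \<alpha> i \<noteq> 0) \<and> (\<Sum>i\<in>J. \<alpha> i *\<^sub>R z i) = 0)"

definition pos_lin_dependent_family :: "'i set \<Rightarrow> ('i \<Rightarrow> 'a::real_vector) \<Rightarrow> bool" where
  "pos_lin_dependent_family J z \<longleftrightarrow>
     (\<exists>\<alpha>. (\<forall>i\<in>J. 0 \<le> \<alpha> i) \<and> (\<exists>i\<in>J. \<alpha> i \<noteq> 0) \<and> (\<Sum>i\<in>J. \<alpha> i *\<^sub>R z i) = 0)"

text \<open>
  For an infinite set \<open>I\<close> of indices, the filter \<open>inf sequentially (principal I)\<close>
  expresses limits along, and sufficiently large, \<open>k \<in> I\<close>.
\<close>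

definition seq_CPLD :: "(real^'n \<Rightarrow> real^'m^'m) \<Rightarrow> real^'n \<Rightarrow> bool" where
  "seq_CPLD G xbar \<longleftrightarrow>
     (let r = rank (G xbar) in
        r = CARD('m) \<or>
        (\<forall>(x :: nat \<Rightarrow> real^'n) (\<Delta> :: nat \<Rightarrow> real^'m^'m).
           x \<longlonglongrightarrow> xbar \<and> range \<Delta> \<subseteq> symmetric_matrices \<and> \<Delta> \<longlonglongrightarrow> 0 \<longrightarrow>
           (\<exists>I E Ebar. infinite I \<and>
              (\<forall>k\<in>I. E k \<in> eigvec_matrices r (G (x k) + \<Delta> k)) \<and>
              (\<forall>i\<in>{1..CARD('m) - r}.
                 ((\<lambda>k. E k i) \<longlongrightarrow> Ebar i) (inf sequentially (principal I))) \<and>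
              (\<forall>J\<subseteq>{1..CARD('m) - r}.
                 pos_lin_dependent_family J (v_diag G xbar Ebar) \<longrightarrow>
                 (\<forall>\<^sub>F k in inf sequentially (principal I).
                    lin_dependent_family J (v_diag G (x k) (E k)))))))"

end

theory Submission
  imports Defs
begin

text \<open>
  If metric subregularity fails, there are points \<open>y \<rightarrow> xbar\<close> whose distance \<open>d\<close> to the feasible set
  is much larger than \<open>\<parallel>\<Pi>(- G y)\<parallel>\<close>. A minimiser \<open>x\<close> of
  \<open>\<parallel>x - y\<parallel>\<^sup>2 + \<rho> dist(G x, psd_cone)\<^sup>2\<close> with \<open>\<rho>\<close> large satisfies
  \<open>d / 2 < \<parallel>x - y\<parallel> \<le> d\<close>, and stationarity writes \<open>x - y\<close> as a nonnegative combination of the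
  vectors \<open>v\<^sub>i\<^sub>i(x, E)\<close> belonging to negative eigenvalues of \<open>G x\<close>. By Caratheodory the combination
  may be taken over a linearly independent subfamily, and then seq-CPLD (used with \<open>\<Delta> = 0\<close>) bounds
  its coefficients by a multiple \<open>C\<close> of \<open>\<parallel>x - y\<parallel>\<close>. Pairing with \<open>x - y\<close> and linearising \<open>G\<close> gives
  \<open>\<parallel>x - y\<parallel> \<le> C \<parallel>\<Pi>(- G y)\<parallel> + o(\<parallel>x - y\<parallel>)\<close>, a contradiction.
\<close>

subsection \<open>Symmetric matrices and their eigenvalues\<close>

lemma symmetric_dot:
  fixes M :: "real^'m^'m"
  assumes "M \<in> symmetric_matrices"
  shows "v \<bullet> (M *v w) = (M *v v) \<bullet> w"
  using assms dot_lmul_matrix[of v M w] by (simp add: symmetric_matrices_def vector_transpose_matrix flip: transpose_matrix_vector)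

text \<open>The rank-one matrix \<open>e e^T\<close>. Its Frobenius pairing with \<open>A\<close> is
  the quadratic form of \<open>A\<close> at \<open>e\<close>, so inequalities for inner products of
  matrices become inequalities for quadratic forms.\<close>

definition outer :: "real^'m \<Rightarrow> real^'m^'m" where
  "outer e = (\<chi> i j. e $ i * e $ j)"

lemma inner_outer: "outer e \<bullet> A = e \<bullet> (A *v e)"
  by (simp add: outer_def inner_vec_def matrix_vector_mult_def sum_distrib_left algebra_simps)

lemma outer_mult_vec: "outer e *v v = (e \<bullet> v) *\<^sub>R e"
  by (simp add: outer_def inner_vec_def matrix_vector_mult_def vec_eq_iff sum_distrib_left sum_distrib_right algebra_simps)

lemma outer_psd: "outer e \<in> psd_cone"
  by (auto simp: psd_cone_def symmetric_matrices_def outer_mult_vec inner_commute)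
     (simp add: outer_def transpose_def vec_eq_iff)

lemma norm_outer: "norm (outer e) = (norm e)\<^sup>2"
  by (simp add: norm_eq_sqrt_inner inner_outer outer_mult_vec)

lemma abs_quadratic_form_le:
  fixes A :: "real^'m^'m"
  shows "\<bar>e \<bullet> (A *v e)\<bar> \<le> norm A * (norm e)\<^sup>2"
  using Cauchy_Schwarz_ineq2[of "outer e" A] by (simp add: inner_outer norm_outer mult.commute)

text \<open>Near \<open>t = 0\<close> the linear term dominates, so it must vanish. This plays the
  part of a first-order optimality condition for quadratic forms.\<close>

lemma quadratic_nonpos_imp_zero:
  fixes a b :: real
  assumes "\<And>t. 2 * t * a + t\<^sup>2 * b \<le> 0"
  shows "a = 0"
proof (rule ccontr)
  assume "a \<noteq> 0"
  \<comment> \<open>The test value is \<open>t = a / s\<close>; the sign is decided by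
    \<open>2 * s + b\<close>, which is positive because \<open>s\<close> exceeds
    \<open>\<bar>b\<bar>\<close>.\<close>
  define s where "s = \<bar>b\<bar> + 1"
  have s: "s > 0" "s > \<bar>b\<bar>" by (auto simp: s_def)
  have "2 * (a / s) * a + (a / s)\<^sup>2 * b = a\<^sup>2 / s\<^sup>2 * (2 * s + b)"
    using s by (simp add: field_simps power2_eq_square)
  moreover have "\<dots> > 0"
    using s \<open>a \<noteq> 0\<close> by (intro mult_pos_pos) auto
  ultimately show False using assms[of "a / s"] by linarith
qed

text \<open>A maximiser of the Rayleigh quotient on an invariant subspace is an eigenvector.\<close>

lemma invariant_subspace_eigenvector:
  fixes M :: "real^'m^'m"
  assumes M: "M \<in> symmetric_matrices" and W: "subspace W" "\<And>w. w \<in> W \<Longrightarrow> M *v w \<in> W"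
    and "dim W \<noteq> 0"
  obtains w where "w \<in> W" "norm w = 1" "M *v w = (w \<bullet> (M *v w)) *\<^sub>R w"
proof -
  let ?S = "W \<inter> sphere 0 1"
  obtain a where a: "a \<in> W" "a \<noteq> 0" using \<open>dim W \<noteq> 0\<close> by (auto simp: dim_eq_0)
  then have "(1 / norm a) *\<^sub>R a \<in> ?S" using W by (simp add: subspace_scale)
  then have "?S \<noteq> {}" by blast
  moreover have "compact ?S"
    using W(1) by (simp add: closed_Int_compact closed_subspace)
  moreover have "continuous_on ?S (\<lambda>v. v \<bullet> (M *v v))"
    by (intro continuous_intros)
  ultimately have "\<exists>w\<in>?S. \<forall>v\<in>?S. v \<bullet> (M *v v) \<le> w \<bullet> (M *v w)"
    by (intro continuous_attains_sup)
  then obtain w where w: "w \<in> ?S" and wmax: "\<And>v. v \<in> ?S \<Longrightarrow> v \<bullet> (M *v v) \<le> w \<bullet> (M *v w)"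
    by blast
  define l where "l = w \<bullet> (M *v w)"
  have l: "v \<bullet> (M *v v) \<le> l * (v \<bullet> v)" if "v \<in> W" for v
  proof (cases "v = 0")
    case False
    have "(1 / norm v) *\<^sub>R v \<in> ?S" using that W False by (simp add: subspace_scale)
    from wmax[OF this] have "(v \<bullet> (M *v v)) / (norm v * norm v) \<le> l"
      by (simp add: l_def matrix_vector_mult_scaleR)
    then show ?thesis using False
      by (simp add: pos_divide_le_eq dot_square_norm power2_eq_square)
  qed simp
  have ww: "w \<in> W" "w \<bullet> w = 1" using w by (auto simp: dot_square_norm)
  \<comment> \<open>The residual of the eigenvalue equation. It lies in \<open>W\<close> and is
    orthogonal to \<open>w\<close>, so perturbing the maximiser along it gives a first-order
    condition that forces its norm to be zero.\<close>
  define v where "v = M *v w - l *\<^sub>R w"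
  have v: "v \<in> W" "v \<bullet> w = 0" "w \<bullet> v = 0" using W ww
    by (auto simp: v_def l_def subspace_diff subspace_scale inner_diff inner_commute)
  have Mwv: "w \<bullet> (M *v v) = v \<bullet> (M *v w)" using symmetric_dot[OF M, of w v] by (simp add: inner_commute)
  have "v \<bullet> (M *v w) = 0"
  proof (rule quadratic_nonpos_imp_zero)
    fix t :: real
    have "w + t *\<^sub>R v \<in> W" using v ww W by (simp add: subspace_add subspace_scale)
    from l[OF this] show "2 * t * (v \<bullet> (M *v w)) + t\<^sup>2 * (v \<bullet> (M *v v) - l * (v \<bullet> v)) \<le> 0"
      using v ww by (simp add: matrix_vector_right_distrib matrix_vector_mult_scaleR inner_add
          Mwv l_def[symmetric] algebra_simps power2_eq_square)
  qed
  moreover have "v \<bullet> (M *v w) = v \<bullet> v + l * (v \<bullet> w)"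
    by (simp add: v_def inner_diff_right)
  ultimately have "v = 0" using v by simp
  then show ?thesis using that[of w] w by (simp add: v_def l_def)
qed

text \<open>Induction on the dimension: split off one unit eigenvector \<open>w\<close>. The part of
  \<open>W\<close> orthogonal to \<open>w\<close> is again invariant, because symmetry moves
  \<open>M\<close> onto \<open>w\<close>.\<close>

lemma invariant_subspace_eigenbasis:
  fixes M :: "real^'m^'m"
  assumes M: "M \<in> symmetric_matrices" and "subspace W" "\<And>w. w \<in> W \<Longrightarrow> M *v w \<in> W"
  shows "\<exists>B\<subseteq>W. finite B \<and> pairwise orthogonal B \<and> card B = dim W \<and>
    (\<forall>b\<in>B. norm b = 1 \<and> M *v b = (b \<bullet> (M *v b)) *\<^sub>R b)"
  using assms(2-)
proof (induction "dim W" arbitrary: W)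
  case 0
  then show ?case by (intro exI[of _ "{}"]) auto
next
  case (Suc n)
  then obtain w where w: "w \<in> W" "norm w = 1" "M *v w = (w \<bullet> (M *v w)) *\<^sub>R w"
    using invariant_subspace_eigenvector[OF M, of W] by (metis Zero_not_Suc)
  define V where "V = {y \<in> W. \<forall>x\<in>span {w}. orthogonal x y}"
  have V: "V = {y \<in> W. orthogonal w y}"
    unfolding V_def by (auto simp: span_singleton orthogonal_def)
  have "dim V + dim (span {w}) = dim W"
    unfolding V_def using w Suc.prems by (intro dim_subspace_orthogonal_to_vectors) (auto simp: span_minimal)
  moreover have "dim (span {w}) = 1" using w by (auto simp: dim_span dim_singleton)
  ultimately have "n = dim V" using Suc by simp
  moreover have "subspace V"
    unfolding V using Suc.prems by (auto simp: subspace_def orthogonal_clauses)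
  moreover have "M *v y \<in> V" if "y \<in> V" for y
    using that Suc.prems symmetric_dot[OF M, of w y] w(3)
    by (simp add: V orthogonal_def) (metis inner_scaleR_left mult_zero_right)
  ultimately obtain B where B: "B \<subseteq> V" "finite B" "pairwise orthogonal B" "card B = dim V"
    "\<forall>b\<in>B. norm b = 1 \<and> M *v b = (b \<bullet> (M *v b)) *\<^sub>R b"
    using Suc.hyps(1)[of V] by blast
  have "w \<notin> V" using w by (auto simp: V orthogonal_def)
  then have "card (insert w B) = dim W"
    using B Suc.hyps(2) \<open>n = dim V\<close> by (subst card_insert_disjoint) auto
  moreover have "pairwise orthogonal (insert w B)"
    using B by (auto simp: pairwise_insert V orthogonal_commute)
  ultimately show ?case
    using B w by (intro exI[of _ "insert w B"]) (auto simp: V)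
qed

section \<open>The roots of the characteristic polynomial and orthonormal eigenvectors\<close>

lemma poly_charpoly:
  fixes M :: "real^'m^'m"
  shows "poly (charpoly M) t = det (t *\<^sub>R mat 1 - M)"
  unfolding charpoly_def det_def
  by (auto simp: poly_sum poly_prod poly_mult mat_def of_int_poly intro!: sum.cong prod.cong)

text \<open>The matrix \<open>P\<close> with columns \<open>B\<close> is orthogonal and satisfies
  \<open>(t I - M) P = P D\<close> with \<open>D\<close> diagonal; determinants then factor the
  polynomial. This ties \<open>eigval\<close>, defined through roots, to eigenvectors with
  multiplicity.\<close>

lemma proots_charpoly:
  fixes M :: "real^'m^'m"
  assumes B: "finite B" "pairwise orthogonal B" "card B = CARD('m)"
    and ev: "\<And>b. b \<in> B \<Longrightarrow> norm b = 1 \<and> M *v b = l b *\<^sub>R b"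
  shows "proots (charpoly M) = image_mset l (mset_set B)"
proof -
  obtain f :: "'m \<Rightarrow> real^'m" where f: "bij_betw f UNIV B"
    using finite_same_card_bij[of "UNIV :: 'm set" B] B by auto
  define P where "P = (\<chi> i j. f j $ i)"
  have col: "column j P = f j" for j by (simp add: P_def column_def)
  have fB: "f j \<in> B" for j using f by (auto simp: bij_betw_def)
  have finj: "f i = f j \<longleftrightarrow> i = j" for i j using f by (auto simp: bij_betw_def inj_def)
  have "orthogonal_matrix P"
    unfolding orthogonal_matrix_orthonormal_columns col
    using ev fB B(2) finj by (auto simp: pairwise_def)
  then have P: "det P \<noteq> 0"
    using det_orthogonal_matrix by fastforce
  have "det (t *\<^sub>R mat 1 - M) = (\<Prod>j\<in>UNIV. t - l (f j))" for t
  proof -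
    define D :: "real^'m^'m" where "D = (\<chi> i j. if i = j then t - l (f j) else 0)"
    have "column j ((t *\<^sub>R mat 1 - M) ** P) = column j (P ** D)" for j
    proof -
      have "column j ((t *\<^sub>R mat 1 - M) ** P) = (t *\<^sub>R mat 1 - M) *v f j"
        by (simp flip: matrix_vector_mult_basis matrix_vector_mul_assoc add: col[symmetric])
      also have "\<dots> = (t - l (f j)) *\<^sub>R f j"
        using ev[OF fB[of j]] by (simp add: matrix_vector_mult_diff_rdistrib scaleR_matrix_vector_assoc[symmetric] algebra_simps)
      also have "\<dots> = column j (P ** D)"
        by (simp add: column_def vec_eq_iff matrix_matrix_mult_def D_def P_def if_distrib cong: if_cong)
      finally show ?thesis .
    qed
    then have "(t *\<^sub>R mat 1 - M) ** P = P ** D"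
      by (simp add: vec_eq_iff column_def)
    then have "det (t *\<^sub>R mat 1 - M) * det P = det P * det D"
      by (metis det_mul)
    then have "det (t *\<^sub>R mat 1 - M) = det D" using P by simp
    then show ?thesis by (simp add: det_diagonal D_def)
  qed
  then have "poly (charpoly M) = poly (\<Prod>j\<in>UNIV. [:- l (f j), 1:])"
    by (auto simp: poly_charpoly poly_prod)
  then have "charpoly M = (\<Prod>j\<in>UNIV. [:- l (f j), 1:])"
    by (simp add: poly_eq_poly_eq_iff)
  then have "proots (charpoly M) = (\<Sum>j\<in>UNIV. {#l (f j)#})"
    by (simp add: proots_prod)
  also have "\<dots> = (\<Sum>b\<in>B. {#l b#})"
    using f by (rule sum.reindex_bij_betw)
  also have "\<dots> = image_mset l (mset_set B)"
    using B(1) by (induction B rule: finite_induct) auto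
  finally show ?thesis .
qed

text \<open>Along an orthonormal family the coefficients of \<open>v\<close> are the inner products
  \<open>v \<bullet> t\<close>. The form covers families that span only a part of the space.\<close>

lemma quadratic_form_orthonormal_eigenvectors:
  fixes M :: "real^'m^'m"
  assumes T: "finite T" "pairwise orthogonal T"
    and ev: "\<And>t. t \<in> T \<Longrightarrow> norm t = 1 \<and> M *v t = l t *\<^sub>R t"
    and v: "v \<in> span T"
  shows "v \<bullet> (M *v v) = (\<Sum>t\<in>T. l t * (v \<bullet> t)\<^sup>2)"
proof -
  obtain c where c: "v = (\<Sum>t\<in>T. c t *\<^sub>R t)"
    using v T(1) by (auto simp: span_finite)
  have "v \<bullet> s = c s" if "s \<in> T" for s
  proof -
    have "v \<bullet> s = (\<Sum>t\<in>T. c t * (t \<bullet> s))" by (simp add: c inner_sum_left)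
    also have "\<dots> = (\<Sum>t\<in>T. if t = s then c s else 0)"
      using T(2) ev that by (intro sum.cong) (auto simp: pairwise_def orthogonal_def dot_square_norm)
    finally show ?thesis using T(1) that by simp
  qed
  moreover have "M *v v = (\<Sum>t\<in>T. (c t * l t) *\<^sub>R t)"
    unfolding c using ev by (simp add: linear_sum[of "(*v) M"] matrix_vector_mult_scaleR)
  then have "v \<bullet> (M *v v) = (\<Sum>t\<in>T. (c t * l t) * (v \<bullet> t))"
    by (simp add: inner_sum_right)
  ultimately show ?thesis
    by (simp add: power2_eq_square mult_ac)
qed

lemma
  fixes M :: "real^'m^'m"
  assumes "E \<in> eigvec_matrices r M"
  shows eigvec_matrices_dot: "\<And>i j. i \<in> {1..CARD('m) - r} \<Longrightarrow> j \<in> {1..CARD('m) - r} \<Longrightarrow>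
      E i \<bullet> E j = (if i = j then 1 else 0)"
    and eigvec_matrices_norm: "\<And>i. i \<in> {1..CARD('m) - r} \<Longrightarrow> norm (E i) = 1"
    and eigvec_matrices_eigenvector: "\<And>i. i \<in> {1..CARD('m) - r} \<Longrightarrow> M *v E i = eigval (r + i) M *\<^sub>R E i"
    and eigvec_matrices_quadratic_form: "\<And>i. i \<in> {1..CARD('m) - r} \<Longrightarrow> E i \<bullet> (M *v E i) = eigval (r + i) M"
  using assms by (auto simp: eigvec_matrices_def norm_eq_1)

text \<open>
  An orthonormal eigenbasis of the orthogonal complement of the columns of \<open>E\<close> carries exactly
  the eigenvalues \<open>\<lambda>\<^sub>1, \<dots>, \<lambda>\<^sub>r\<close>. If one of them were nonpositive, \<open>M\<close> would be negative
  semidefinite on a space of dimension \<open>m - r + 1\<close>, which meets \<open>S\<close>.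
\<close>

lemma quadratic_form_nonneg_on_eigvec_complement:
  fixes M :: "real^'m^'m"
  assumes M: "M \<in> symmetric_matrices" and E: "E \<in> eigvec_matrices r M" and r: "r \<le> CARD('m)"
    and S: "subspace S" "dim S = r" "\<And>v. v \<in> S \<Longrightarrow> v \<noteq> 0 \<Longrightarrow> 0 < v \<bullet> (M *v v)"
    and w: "\<And>i. i \<in> {1..CARD('m) - r} \<Longrightarrow> E i \<bullet> w = 0"
  shows "0 \<le> w \<bullet> (M *v w)"
proof -
  define m where "m = CARD('m)"
  define l where "l b = b \<bullet> (M *v b)" for b
  define A where "A = E ` {1..m - r}"
  have EE: "E i \<bullet> E j = (if i = j then 1 else 0)" if "i \<in> {1..m - r}" "j \<in> {1..m - r}" for i j
    using eigvec_matrices_dot[OF E] that by (simp add: m_def)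
  have inj: "inj_on E {1..m - r}"
  proof (rule inj_onI)
    fix i j assume *: "i \<in> {1..m - r}" "j \<in> {1..m - r}" "E i = E j"
    then have "E i \<bullet> E j = 1" using EE by metis
    then show "i = j" using EE[OF *(1,2)] by (auto split: if_splits)
  qed
  have A: "finite A" "card A = m - r" "pairwise orthogonal A"
    using inj EE by (auto simp: A_def card_image pairwise_def orthogonal_def)
  have lE: "l (E i) = eigval (r + i) M" if "i \<in> {1..m - r}" for i
    using that eigvec_matrices_quadratic_form[OF E] by (simp add: l_def m_def)
  have Aev: "norm b = 1 \<and> M *v b = l b *\<^sub>R b" if b: "b \<in> A" for b
  proof -
    obtain i where i: "i \<in> {1..m - r}" "b = E i" using b by (auto simp: A_def)
    then show ?thesis
      using eigvec_matrices_norm[OF E, of i] eigvec_matrices_eigenvector[OF E, of i] lE[of i] by (simp add: m_def)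
  qed
  define W where "W = {y \<in> UNIV. \<forall>x\<in>span A. orthogonal x y}"
  have W': "W = {y. \<forall>x\<in>A. orthogonal x y}"
    unfolding W_def by (auto intro: span_base) (metis orthogonal_commute orthogonal_to_span)
  have "independent A"
    using A Aev[of 0] by (intro pairwise_orthogonal_independent) auto
  then have "dim (span A) = m - r" using A by (simp add: dim_eq_card_independent)
  moreover have "dim W + dim (span A) = dim (UNIV :: (real^'m) set)"
    unfolding W_def by (intro dim_subspace_orthogonal_to_vectors) auto
  ultimately have dW: "dim W = r" using r by (simp add: m_def)
  have sW: "subspace W" by (auto simp: W' subspace_def orthogonal_clauses)
  have "M *v y \<in> W" if "y \<in> W" for y
    unfolding W'
  proof clarify
    fix x assume "x \<in> A"
    then have "x \<bullet> (M *v y) = l x * (x \<bullet> y)" by (simp add: symmetric_dot[OF M] Aev)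
    then show "orthogonal x (M *v y)" using \<open>x \<in> A\<close> that by (simp add: W' orthogonal_def)
  qed
  then obtain B where B: "B \<subseteq> W" "finite B" "pairwise orthogonal B" "card B = r"
    "\<And>b. b \<in> B \<Longrightarrow> norm b = 1 \<and> M *v b = l b *\<^sub>R b"
    using invariant_subspace_eigenbasis[OF M sW] dW unfolding l_def by blast
  have AB: "orthogonal a b" if "a \<in> A" "b \<in> W" for a b using that by (auto simp: W')
  have "A \<inter> B = {}" using AB B Aev by (fastforce simp: orthogonal_def)
  define C where "C = A \<union> B"
  have C: "finite C" "card C = CARD('m)"
    using A B \<open>A \<inter> B = {}\<close> r by (auto simp: C_def card_Un_disjoint m_def)
  have "pairwise orthogonal C"
    using A(3) B(1,3) AB unfolding C_def pairwise_def by (meson UnE orthogonal_commute subsetD)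
  then have pr: "proots (charpoly M) = image_mset l (mset_set C)"
    using C Aev B(5) by (intro proots_charpoly) (auto simp: C_def)
  define L where "L = rev (sorted_list_of_multiset (proots (charpoly M)))"
  have mL: "mset L = image_mset l (mset_set A) + image_mset l (mset_set B)"
    using A B \<open>A \<inter> B = {}\<close> by (simp add: L_def pr C_def mset_set_Union)
  have lenL: "length L = m"
    using arg_cong[OF mL, of size] A B r by (simp add: m_def)
  have L: "L ! (r + i - 1) = l (E i)" if "i \<in> {1..m - r}" for i
    using lE[OF that] by (simp add: eigval_def L_def)
  \<comment> \<open>\<open>eigval i\<close> reads entry \<open>i - 1\<close> of the decreasing list
    \<open>L\<close>, and columns are numbered from 1, so entry \<open>r + i - 1\<close> belongs to
    \<open>E i\<close>. The last \<open>m - r\<close> entries are thus those of \<open>A\<close>;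
    cancelling them in the multiset leaves the first \<open>r\<close> entries for
    \<open>B\<close>.\<close>
  have "drop r L = map (\<lambda>i. l (E i)) [1..<Suc (m - r)]"
  proof (rule nth_equalityI)
    fix i assume "i < length (drop r L)"
    then have "i + 1 \<in> {1..m - r}" "i < m - r" using lenL by auto
    then show "drop r L ! i = map (\<lambda>i. l (E i)) [1..<Suc (m - r)] ! i"
      using L[of "i + 1"] lenL by (simp del: upt_Suc)
  qed (simp add: lenL del: upt_Suc)
  then have "mset (drop r L) = image_mset l (image_mset E (mset_set {1..m - r}))"
    by (simp add: multiset.map_comp o_def atLeastLessThanSuc_atLeastAtMost del: upt_Suc)
  also have "\<dots> = image_mset l (mset_set A)"
    using inj by (simp add: A_def image_mset_mset_set)
  finally have "mset (take r L) = image_mset l (mset_set B)"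
    using mL by (metis add.commute add_left_cancel append_take_drop_id mset_append)
  then have tL: "set (take r L) = l ` B"
    using B by (metis finite_set_mset_mset_set set_image_mset set_mset_mset)
  have decL: "L ! j \<le> L ! i" if "i \<le> j" "j < m" for i j
    using that lenL sorted_sorted_list_of_multiset[of "proots (charpoly M)"]
    unfolding L_def by (simp add: sorted_rev_iff_nth_mono[symmetric] sorted_rev_nth_mono)
  have pos: "0 < l b" if b: "b \<in> B" for b
  proof (rule ccontr)
    assume nb: "\<not> 0 < l b"
    have "l b \<in> set (take r L)" using tL b by simp
    then obtain j where j: "j < r" "L ! j = l b" using lenL r
      by (auto simp: in_set_conv_nth m_def)
    \<comment> \<open>The nonpositive value \<open>l b\<close> sits at a position
      \<open>j < r\<close>, and the columns of \<open>E\<close> occupy later positions of the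
      decreasing list.\<close>
    have lA: "l a \<le> 0" if "a \<in> A" for a
    proof -
      obtain i where i: "i \<in> {1..m - r}" "a = E i" using \<open>a \<in> A\<close> by (auto simp: A_def)
      then have "L ! (r + i - 1) \<le> L ! j" using j by (intro decL) auto
      then show ?thesis using L[OF i(1)] j nb i by simp
    qed
    define T where "T = insert b A"
    have "b \<notin> A" using b \<open>A \<inter> B = {}\<close> by auto
    have T: "finite T" "card T = m - r + 1" "pairwise orthogonal T"
      using A \<open>b \<notin> A\<close> AB b B(1) by (auto simp: T_def pairwise_insert orthogonal_commute)
    have Tev: "norm t = 1 \<and> M *v t = l t *\<^sub>R t" if "t \<in> T" for t
      using that Aev B(5) b by (auto simp: T_def)
    have "independent T" using T Tev[of 0] by (intro pairwise_orthogonal_independent) auto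
    then have "dim (span T) = m - r + 1" using T by (simp add: dim_eq_card_independent)
    moreover have "dim {x + y |x y. x \<in> S \<and> y \<in> span T} + dim (S \<inter> span T) = dim S + dim (span T)"
      using S by (intro dim_sums_Int) auto
    moreover have "dim {x + y |x y. x \<in> S \<and> y \<in> span T} \<le> m"
      using dim_subset_UNIV[of "{x + y |x y. x \<in> S \<and> y \<in> span T}"] by (simp add: m_def)
    ultimately have "dim (S \<inter> span T) \<noteq> 0" using S(2) r unfolding m_def by linarith
    then obtain v where v: "v \<in> S" "v \<in> span T" "v \<noteq> 0" by (auto simp: dim_eq_0)
    have "v \<bullet> (M *v v) = (\<Sum>t\<in>T. l t * (v \<bullet> t)\<^sup>2)"
      using T Tev v by (intro quadratic_form_orthonormal_eigenvectors) auto
    also have "\<dots> \<le> 0"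
      using lA nb by (intro sum_nonpos) (auto simp: T_def mult_nonpos_nonneg)
    finally show False using S(3)[of v] v by simp
  qed
  have "independent B" using B(3) B(5)[of 0] by (intro pairwise_orthogonal_independent) auto
  then have "W \<subseteq> span B" using B dW by (intro card_ge_dim_independent) auto
  moreover have "w \<in> W" using w by (auto simp: W' A_def orthogonal_def m_def)
  ultimately have "w \<bullet> (M *v w) = (\<Sum>b\<in>B. l b * (w \<bullet> b)\<^sup>2)"
    using B by (intro quadratic_form_orthonormal_eigenvectors) auto
  also have "\<dots> \<ge> 0" using pos by (intro sum_nonneg mult_nonneg_nonneg) (auto intro: less_imp_le)
  finally show ?thesis .
qed

subsection \<open>The positive semidefinite cone\<close>

text \<open>Such a \<open>v\<close> minimises the quadratic form, so the first-order term in the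
  direction \<open>u = - (M *v v)\<close> vanishes, and that term is the squared norm of
  \<open>M *v v\<close> up to sign.\<close>

lemma psd_quadratic_form_eq_0:
  fixes M :: "real^'m^'m"
  assumes M: "M \<in> psd_cone" and v: "v \<bullet> (M *v v) = 0"
  shows "M *v v = 0"
proof -
  have sym: "M \<in> symmetric_matrices" using M by (simp add: psd_cone_def)
  define u where "u = - (M *v v)"
  have "v \<bullet> (M *v u) = u \<bullet> (M *v v)" using symmetric_dot[OF sym, of v u] by (simp add: inner_commute)
  then have "2 * t * (- (u \<bullet> (M *v v))) + t\<^sup>2 * (- (u \<bullet> (M *v u))) \<le> 0" for t
    using M v unfolding psd_cone_def
    by (auto dest!: spec[of _ "v + t *\<^sub>R u"]
        simp: matrix_vector_right_distrib matrix_vector_mult_scaleR inner_add algebra_simps power2_eq_square)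
  from quadratic_nonpos_imp_zero[OF this] show ?thesis by (simp add: u_def)
qed

text \<open>\<open>S\<close> is the range of \<open>M\<close>, which meets the kernel only in 0 by
  symmetry. Compactness of the unit sphere of \<open>S\<close> makes the positivity uniform, so that
  it survives perturbations of \<open>M\<close> of norm below \<open>c\<close>.\<close>

lemma psd_positive_on_rank_subspace:
  fixes M :: "real^'m^'m"
  assumes M: "M \<in> psd_cone"
  obtains S c where "subspace S" "dim S = rank M" "c > 0" "\<And>v. v \<in> S \<Longrightarrow> c * (v \<bullet> v) \<le> v \<bullet> (M *v v)"
proof -
  have sym: "M \<in> symmetric_matrices" using M by (simp add: psd_cone_def)
  define S where "S = range ((*v) M)"
  have S: "subspace S" "dim S = rank M"
    by (auto simp: S_def rank_dim_range linear_subspace_image)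
  have pos: "0 < v \<bullet> (M *v v)" if "v \<in> S" "v \<noteq> 0" for v
  proof -
    obtain w where w: "v = M *v w" using \<open>v \<in> S\<close> by (auto simp: S_def)
    have "M *v v \<noteq> 0"
    proof
      assume "M *v v = 0"
      then have "v \<bullet> v = 0" using symmetric_dot[OF sym, of v w] w by simp
      then show False using that by simp
    qed
    then show ?thesis using psd_quadratic_form_eq_0[OF M, of v] M by (force simp: psd_cone_def order_less_le)
  qed
  have "\<exists>c>0. \<forall>v\<in>S \<inter> sphere 0 1. c \<le> v \<bullet> (M *v v)"
  \<comment> \<open>If \<open>S\<close> has no unit vectors, any positive constant serves, and 1 is
    taken.\<close>
  proof (cases "S \<inter> sphere 0 1 = {}")
    case False
    have "\<exists>w\<in>S \<inter> sphere 0 1. \<forall>v\<in>S \<inter> sphere 0 1. w \<bullet> (M *v w) \<le> v \<bullet> (M *v v)"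
      using False S(1) by (intro continuous_attains_inf continuous_intros)
        (auto simp: closed_Int_compact closed_subspace)
    then obtain w where w: "w\<in>S \<inter> sphere 0 1" "\<forall>v\<in>S \<inter> sphere 0 1. w \<bullet> (M *v w) \<le> v \<bullet> (M *v v)"
      by blast
    moreover have "w \<noteq> 0" using w(1) by auto
    ultimately show ?thesis using pos[of w] by (intro exI[of _ "w \<bullet> (M *v w)"]) auto
  qed (auto intro: exI[of _ 1])
  then obtain c where c: "c > 0" "\<forall>v\<in>S \<inter> sphere 0 1. c \<le> v \<bullet> (M *v v)" by blast
  have "c * (v \<bullet> v) \<le> v \<bullet> (M *v v)" if "v \<in> S" for v
  proof (cases "v = 0")
    case False
    have "(1 / norm v) *\<^sub>R v \<in> S \<inter> sphere 0 1" using that S False by (simp add: subspace_scale)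
    with c have "c \<le> ((1 / norm v) *\<^sub>R v) \<bullet> (M *v ((1 / norm v) *\<^sub>R v))" by blast
    then have "c \<le> (v \<bullet> (M *v v)) / (norm v * norm v)"
      by (simp add: matrix_vector_mult_scaleR)
    then show ?thesis using False
      by (simp add: pos_le_divide_eq dot_square_norm power2_eq_square)
  qed simp
  then show ?thesis using that S c(1) by blast
qed

section \<open>Cone properties and projection onto the cone\<close>

lemma symmetric_matrices_add:
  "M \<in> symmetric_matrices \<Longrightarrow> N \<in> symmetric_matrices \<Longrightarrow> M + N \<in> symmetric_matrices"
  by (simp add: symmetric_matrices_def transpose_def vec_eq_iff)

lemma symmetric_matrices_scaleR: "M \<in> symmetric_matrices \<Longrightarrow> c *\<^sub>R M \<in> symmetric_matrices"
  by (simp add: symmetric_matrices_def transpose_def vec_eq_iff)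

lemma psd_cone_add: "M \<in> psd_cone \<Longrightarrow> N \<in> psd_cone \<Longrightarrow> M + N \<in> psd_cone"
  by (simp add: psd_cone_def symmetric_matrices_add matrix_vector_mult_add_rdistrib inner_add_right)

lemma psd_cone_scaleR: "M \<in> psd_cone \<Longrightarrow> 0 \<le> c \<Longrightarrow> c *\<^sub>R M \<in> psd_cone"
  by (simp add: psd_cone_def symmetric_matrices_scaleR scaleR_matrix_vector_assoc[symmetric])

lemma zero_in_psd_cone: "0 \<in> psd_cone"
  by (simp add: psd_cone_def symmetric_matrices_def transpose_def vec_eq_iff)

lemma convex_psd_cone: "convex psd_cone"
  by (auto simp: convex_def intro: psd_cone_add psd_cone_scaleR)

lemma closed_psd_cone: "closed (psd_cone :: (real^'m^'m) set)"
proof -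
  have "psd_cone = (\<Inter>i j. {M :: real^'m^'m. M $ j $ i = M $ i $ j}) \<inter> (\<Inter>v. {M. 0 \<le> outer v \<bullet> M})"
    by (auto simp: psd_cone_def symmetric_matrices_def transpose_def vec_eq_iff inner_outer)
  also have "closed \<dots>"
    by (intro closed_Int closed_INT ballI closed_Collect_eq closed_Collect_le continuous_intros)
  finally show ?thesis .
qed

text \<open>The variational inequality of the closest point, tested at
  \<open>proj_psd M + N\<close>, which stays in the cone.\<close>

lemma inner_le_inner_proj_psd:
  fixes M N :: "real^'m^'m"
  assumes "N \<in> psd_cone"
  shows "N \<bullet> M \<le> N \<bullet> proj_psd M"
proof -
  have "proj_psd M \<in> psd_cone"
    unfolding proj_psd_def using closed_psd_cone zero_in_psd_cone by (intro closest_point_in_set) auto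
  then have "(M - proj_psd M) \<bullet> ((proj_psd M + N) - proj_psd M) \<le> 0"
    unfolding proj_psd_def using assms
    by (intro closest_point_dot closed_psd_cone convex_psd_cone psd_cone_add)
  then show ?thesis by (simp add: algebra_simps inner_commute)
qed

text \<open>\<open>P\<close> lifts the negative eigenvalues among the columns of \<open>E\<close> to
  zero, and \<open>compl\<close> controls the remaining directions. Optimality follows from
  \<open>P \<bullet> (N + P) = 0\<close> and \<open>P \<bullet> S \<ge> 0\<close> by Cauchy-Schwarz.
  The explicit \<open>P\<close> later supplies the multipliers.\<close>

lemma closest_psd_point:
  fixes N :: "real^'m^'m"
  assumes N: "N \<in> symmetric_matrices" and E: "E \<in> eigvec_matrices r N"
    and compl: "\<And>w. (\<And>i. i \<in> {1..CARD('m) - r} \<Longrightarrow> E i \<bullet> w = 0) \<Longrightarrow> 0 \<le> w \<bullet> (N *v w)"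
  defines "P \<equiv> \<Sum>i\<in>{1..CARD('m) - r}. max 0 (- eigval (r + i) N) *\<^sub>R outer (E i)"
  shows "N + P \<in> psd_cone" "\<And>S. S \<in> psd_cone \<Longrightarrow> norm P \<le> dist N S"
proof -
  define K where "K = {1..CARD('m) - r}"
  define l where "l i = eigval (r + i) N" for i
  define a where "a i = max 0 (- l i)" for i
  note dot = eigvec_matrices_dot[OF E, folded K_def]
  note ev = eigvec_matrices_eigenvector[OF E, folded K_def l_def]
  have P: "P = (\<Sum>i\<in>K. a i *\<^sub>R outer (E i))" by (simp add: P_def K_def l_def a_def)
  have quadP: "v \<bullet> (P *v v) = (\<Sum>i\<in>K. a i * (E i \<bullet> v)\<^sup>2)" for v
    by (simp add: inner_outer[symmetric] P inner_sum_right)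
       (simp add: inner_outer outer_mult_vec power2_eq_square inner_commute)
  have PS: "P \<bullet> S = (\<Sum>i\<in>K. a i * (E i \<bullet> (S *v E i)))" for S
    by (simp add: P inner_sum_left inner_outer)
  \<comment> \<open>After the correction the eigenvalue is \<open>l i + a i = max 0 (l i)\<close>;
    the second fact is complementarity.\<close>
  have al: "l i + a i \<ge> 0" "a i * (l i + a i) = 0" for i by (auto simp: a_def max_def)
  have finK: "finite K" by (simp add: K_def)
  have "P \<in> psd_cone"
    unfolding P using finK
    by (induction K rule: finite_induct) (auto simp: zero_in_psd_cone a_def intro!: psd_cone_add psd_cone_scaleR outer_psd)
  then have "N + P \<in> symmetric_matrices" using N by (simp add: psd_cone_def symmetric_matrices_add)
  moreover have "0 \<le> v \<bullet> ((N + P) *v v)" for v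
  proof -
    \<comment> \<open>Split \<open>v\<close> into its projection \<open>p\<close> onto the columns
      of \<open>E\<close> and a remainder \<open>w\<close>. The span of the columns is invariant
      under \<open>N\<close>, so the cross terms vanish.\<close>
    define p where "p = (\<Sum>i\<in>K. (E i \<bullet> v) *\<^sub>R E i)"
    define w where "w = v - p"
    have Ep: "E i \<bullet> p = E i \<bullet> v" if "i \<in> K" for i
    proof -
      have "E i \<bullet> p = (\<Sum>j\<in>K. if j = i then E i \<bullet> v else 0)"
        unfolding p_def inner_sum_right using dot that by (intro sum.cong) auto
      then show ?thesis using that finK by simp
    qed
    have wE: "E i \<bullet> w = 0" if "i \<in> K" for i using Ep[OF that] by (simp add: w_def inner_diff_right)
    have Np: "N *v p = (\<Sum>i\<in>K. (l i * (E i \<bullet> v)) *\<^sub>R E i)"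
      unfolding p_def by (simp add: linear_sum[of "(*v) N"] matrix_vector_mult_scaleR ev mult.commute)
    then have "w \<bullet> (N *v p) = 0" using wE by (simp add: inner_sum_right inner_commute)
    moreover have "p \<bullet> (N *v w) = w \<bullet> (N *v p)" using symmetric_dot[OF N, of p w] by (simp add: inner_commute)
    moreover have "p \<bullet> (N *v p) = (\<Sum>i\<in>K. l i * (E i \<bullet> v)\<^sup>2)"
      unfolding Np inner_sum_right
      by (intro sum.cong) (auto simp: inner_commute[of p] Ep power2_eq_square)
    moreover have "v = w + p" by (simp add: w_def)
    ultimately have "v \<bullet> (N *v v) = w \<bullet> (N *v w) + (\<Sum>i\<in>K. l i * (E i \<bullet> v)\<^sup>2)"
      by (simp add: matrix_vector_right_distrib inner_add)
    then have "v \<bullet> ((N + P) *v v) = w \<bullet> (N *v w) + (\<Sum>i\<in>K. (l i + a i) * (E i \<bullet> v)\<^sup>2)"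
      by (simp add: matrix_vector_mult_add_rdistrib inner_add quadP sum.distrib[symmetric] algebra_simps)
    moreover have "0 \<le> w \<bullet> (N *v w)" using wE by (intro compl) (simp add: K_def)
    moreover have "0 \<le> (\<Sum>i\<in>K. (l i + a i) * (E i \<bullet> v)\<^sup>2)" using al(1) by (intro sum_nonneg) auto
    ultimately show ?thesis by simp
  qed
  ultimately show "N + P \<in> psd_cone" by (simp add: psd_cone_def)
  fix S :: "real^'m^'m" assume S: "S \<in> psd_cone"
  have "0 \<le> P \<bullet> S"
    unfolding PS using S by (intro sum_nonneg) (auto simp: psd_cone_def a_def)
  moreover have "P *v E i = a i *\<^sub>R E i" if "i \<in> K" for i
  proof -
    have "P *v E i = (\<Sum>j\<in>K. a j *\<^sub>R ((E j \<bullet> E i) *\<^sub>R E j))"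
      unfolding P using finK
      by (induction K rule: finite_induct)
         (auto simp: matrix_vector_mult_add_rdistrib outer_mult_vec scaleR_matrix_vector_assoc[symmetric])
    also have "\<dots> = (\<Sum>j\<in>K. if j = i then a i *\<^sub>R E i else 0)"
      using dot that by (intro sum.cong) auto
    finally have "P *v E i = \<dots>" .
    then show ?thesis using that finK by simp
  qed
  then have "P \<bullet> (N + P) = (\<Sum>i\<in>K. a i * (l i + a i))"
    unfolding PS using dot ev
    by (intro sum.cong) (auto simp: matrix_vector_mult_add_rdistrib inner_add_right)
  then have "P \<bullet> (N + P) = 0" by (simp add: al)
  ultimately have "P \<bullet> P \<le> P \<bullet> (S - N)" by (simp add: inner_diff_right inner_add_right)
  also have "\<dots> \<le> norm P * norm (S - N)" by (rule norm_cauchy_schwarz)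
  finally have "norm P * norm P \<le> norm P * dist N S"
    by (simp add: dist_norm norm_minus_commute dot_square_norm power2_eq_square)
  then show "norm P \<le> dist N S"
    by (cases "norm P = 0") auto
qed

subsection \<open>Positive combinations\<close>

lemma conic_caratheodory_pos:
  fixes v :: "'i \<Rightarrow> 'a::real_vector"
  assumes "finite A" "\<And>i. i \<in> A \<Longrightarrow> 0 < b i"
  shows "\<exists>J c. J \<subseteq> A \<and> (\<forall>i\<in>J. 0 < c i) \<and> \<not> lin_dependent_family J v \<and>
    (\<Sum>i\<in>J. c i *\<^sub>R v i) = (\<Sum>i\<in>A. b i *\<^sub>R v i)"
  using assms
proof (induction "card A" arbitrary: A b rule: less_induct)
  case less
  show ?case
  proof (cases "lin_dependent_family A v")
    case False
    then show ?thesis using less.prems by (intro exI[of _ A] exI[of _ b]) auto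
  next
    case True
    then obtain a0 where a0: "\<exists>i\<in>A. a0 i \<noteq> 0" "(\<Sum>i\<in>A. a0 i *\<^sub>R v i) = 0"
      by (auto simp: lin_dependent_family_def)
    \<comment> \<open>Up to a change of sign the dependence has a positive coefficient, so
      subtracting multiples of it eventually exhausts some weight.\<close>
    have "\<exists>a. (\<exists>i\<in>A. a i > 0) \<and> (\<Sum>i\<in>A. a i *\<^sub>R v i) = 0"
    proof (cases "\<exists>i\<in>A. a0 i > 0")
      case False
      then have "\<exists>i\<in>A. - a0 i > 0" using a0(1) by (auto simp: not_less order.order_iff_strict)
      then show ?thesis using a0(2) by (intro exI[of _ "\<lambda>i. - a0 i"]) (auto simp: sum_negf)
    qed (use a0 in blast)
    then obtain a where a: "\<exists>i\<in>A. a i > 0" "(\<Sum>i\<in>A. a i *\<^sub>R v i) = 0" by blast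
    \<comment> \<open>The minimum of these ratios is the longest step that keeps all weights
      nonnegative; at a minimising index \<open>k\<close> the new weight is zero.\<close>
    define Q where "Q = (\<lambda>i. b i / a i) ` {i\<in>A. a i > 0}"
    define t where "t = Min Q"
    have Q: "finite Q" "Q \<noteq> {}" using a less.prems by (auto simp: Q_def)
    then have "t \<in> Q" by (simp add: t_def)
    then obtain k where k: "k \<in> A" "a k > 0" "t = b k / a k" by (auto simp: Q_def)
    have "t > 0" using k less.prems by auto
    define b' where "b' i = b i - t * a i" for i
    have b': "b' i \<ge> 0" if "i \<in> A" for i
    proof (cases "a i > 0")
      case True
      then have "t \<le> b i / a i" unfolding t_def using that Q by (intro Min_le) (auto simp: Q_def)
      then show ?thesis using True by (simp add: b'_def pos_le_divide_eq)
    next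
      case False
      then show ?thesis using less.prems(2)[OF that] \<open>t > 0\<close>
        by (simp add: b'_def mult_nonneg_nonpos order.trans[of _ 0])
    qed
    have "b' k = 0" using k by (simp add: b'_def)
    \<comment> \<open>Every index whose weight has dropped to zero is discarded, since the induction
      hypothesis asks for strictly positive weights.\<close>
    define A' where "A' = {i\<in>A. b' i > 0}"
    have A': "A' \<subseteq> A - {k}" using \<open>b' k = 0\<close> by (auto simp: A'_def)
    have "card A' < card A"
      using A' k(1) less.prems(1) by (intro psubset_card_mono) auto
    moreover have fA': "finite A'" "\<And>i. i \<in> A' \<Longrightarrow> 0 < b' i"
      using less.prems(1) by (auto simp: A'_def)
    ultimately have "\<exists>J c. J \<subseteq> A' \<and> (\<forall>i\<in>J. 0 < c i) \<and> \<not> lin_dependent_family J v \<and>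
      (\<Sum>i\<in>J. c i *\<^sub>R v i) = (\<Sum>i\<in>A'. b' i *\<^sub>R v i)"
      by (rule less.hyps)
    then obtain J c where J: "J \<subseteq> A'" "\<forall>i\<in>J. 0 < c i" "\<not> lin_dependent_family J v"
      "(\<Sum>i\<in>J. c i *\<^sub>R v i) = (\<Sum>i\<in>A'. b' i *\<^sub>R v i)"
      by blast
    have "(\<Sum>i\<in>A'. b' i *\<^sub>R v i) = (\<Sum>i\<in>A. b' i *\<^sub>R v i)"
      using less.prems(1) b' by (intro sum.mono_neutral_left) (auto simp: A'_def order.order_iff_strict)
    also have "\<dots> = (\<Sum>i\<in>A. b i *\<^sub>R v i) - t *\<^sub>R (\<Sum>i\<in>A. a i *\<^sub>R v i)"
      by (simp add: b'_def algebra_simps sum_subtractf scaleR_sum_right)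
    finally show ?thesis using J A' a by (intro exI[of _ J] exI[of _ c]) auto
  qed
qed

lemma conic_caratheodory:
  fixes v :: "'i \<Rightarrow> 'a::real_vector"
  assumes A: "finite A" "\<And>i. i \<in> A \<Longrightarrow> 0 \<le> b i"
  obtains J c where "J \<subseteq> {i\<in>A. 0 < b i}" "\<And>i. i \<in> J \<Longrightarrow> 0 < c i" "\<not> lin_dependent_family J v"
    "(\<Sum>i\<in>J. c i *\<^sub>R v i) = (\<Sum>i\<in>A. b i *\<^sub>R v i)"
proof -
  have "(\<Sum>i\<in>{i\<in>A. 0 < b i}. b i *\<^sub>R v i) = (\<Sum>i\<in>A. b i *\<^sub>R v i)"
    using A by (intro sum.mono_neutral_left) (auto simp: order.order_iff_strict)
  moreover have "\<exists>J c. J \<subseteq> {i\<in>A. 0 < b i} \<and> (\<forall>i\<in>J. 0 < c i) \<and> \<not> lin_dependent_family J v \<and>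
    (\<Sum>i\<in>J. c i *\<^sub>R v i) = (\<Sum>i\<in>{i\<in>A. 0 < b i}. b i *\<^sub>R v i)"
    using A(1) by (intro conic_caratheodory_pos) auto
  ultimately show ?thesis using that by metis
qed

text \<open>The hull sees only the set of values, while the family may repeat members. Each value
  therefore passes its weight to one representative index in \<open>K\<close>, and all other indices
  get weight 0.\<close>

lemma zero_in_convex_hull_imp_pos_lin_dependent:
  assumes J: "finite J" and "0 \<in> convex hull (z ` J)"
  shows "pos_lin_dependent_family J z"
proof -
  obtain u where u: "\<forall>x\<in>z ` J. 0 \<le> u x" "sum u (z ` J) = 1" "(\<Sum>x\<in>z ` J. u x *\<^sub>R x) = 0"
    using assms by (auto simp: convex_hull_finite)
  obtain K where K: "K \<subseteq> J" "inj_on z K" "z ` J = z ` K"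
    by (metis subset_image_inj subset_refl)
  define a where "a i = (if i \<in> K then u (z i) else 0)" for i
  have "(\<Sum>i\<in>J. a i *\<^sub>R z i) = (\<Sum>i\<in>K. a i *\<^sub>R z i)"
    using J K by (intro sum.mono_neutral_right) (auto simp: a_def)
  also have "\<dots> = (\<Sum>x\<in>z ` J. u x *\<^sub>R x)"
    unfolding K(3) using K by (simp add: sum.reindex a_def)
  finally have "(\<Sum>i\<in>J. a i *\<^sub>R z i) = 0" using u by simp
  moreover have "\<forall>i\<in>J. 0 \<le> a i" using u K by (auto simp: a_def)
  moreover have "(\<Sum>i\<in>K. u (z i)) \<noteq> 0"
    using u(2) K by (simp add: sum.reindex)
  then obtain i where "i \<in> K" "u (z i) \<noteq> 0" by (metis sum.neutral)
  then have "\<exists>i\<in>J. a i \<noteq> 0" using K by (auto simp: a_def)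
  ultimately show ?thesis unfolding pos_lin_dependent_family_def by blast
qed

text \<open>The constant is the distance of 0 from the compact convex hull of the members; dividing
  a nonnegative combination by its total weight puts it into the hull.\<close>

lemma not_pos_lin_dependent_bound:
  fixes z :: "'i \<Rightarrow> 'a::real_normed_vector"
  assumes J: "finite J" and "\<not> pos_lin_dependent_family J z"
  obtains c where "c > 0" "\<And>g :: 'i \<Rightarrow> real. (\<And>i. i \<in> J \<Longrightarrow> 0 \<le> g i) \<Longrightarrow> c * sum g J \<le> norm (\<Sum>i\<in>J. g i *\<^sub>R z i)"
proof (cases "J = {}")
  case True
  then show ?thesis using that[of 1] by simp
next
  case False
  define H where "H = convex hull (z ` J)"
  have H: "compact H" "H \<noteq> {}" "0 \<notin> H" "convex H"
    using assms False zero_in_convex_hull_imp_pos_lin_dependent[OF J]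
    by (auto simp: H_def finite_imp_compact_convex_hull)
  have "\<exists>x\<in>H. \<forall>y\<in>H. norm x \<le> norm y"
    using H by (intro continuous_attains_inf continuous_intros)
  then obtain x where x: "x \<in> H" "\<And>y. y \<in> H \<Longrightarrow> norm x \<le> norm y" by blast
  show ?thesis
  proof (rule that[of "norm x"])
    show "norm x > 0" using x H by auto
    fix g :: "'i \<Rightarrow> real" assume g: "\<And>i. i \<in> J \<Longrightarrow> 0 \<le> g i"
    define s where "s = sum g J"
    have "s \<ge> 0" using g by (simp add: s_def sum_nonneg)
    show "norm x * sum g J \<le> norm (\<Sum>i\<in>J. g i *\<^sub>R z i)"
    proof (cases "s = 0")
      case False
      then have "s > 0" using \<open>s \<ge> 0\<close> by simp
      have "(\<Sum>i\<in>J. (g i / s) *\<^sub>R z i) \<in> H"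
        using J H g \<open>s > 0\<close> by (intro convex_sum) (auto simp: sum_divide_distrib[symmetric] s_def H_def hull_inc)
      moreover have "(\<Sum>i\<in>J. (g i / s) *\<^sub>R z i) = (1 / s) *\<^sub>R (\<Sum>i\<in>J. g i *\<^sub>R z i)"
        by (simp add: scaleR_sum_right)
      ultimately have "norm x \<le> norm (\<Sum>i\<in>J. g i *\<^sub>R z i) / s"
        using x(2) \<open>s > 0\<close> by fastforce
      then show ?thesis using \<open>s > 0\<close> by (simp add: s_def pos_le_divide_eq)
    qed (simp add: s_def)
  qed
qed

text \<open>
  If the limit family is not positively linearly dependent on \<open>J\<close>, then \<open>0\<close> has positive distance
  from the convex hull of its members; otherwise \<open>dep\<close> makes the claim vacuous for \<open>J\<close>.
\<close>

lemma eventually_coefficients_bounded: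
  fixes z :: "'k \<Rightarrow> 'i \<Rightarrow> 'a::real_normed_vector"
  assumes K: "finite K" and lim: "\<And>i. i \<in> K \<Longrightarrow> ((\<lambda>k. z k i) \<longlongrightarrow> zbar i) F"
    and dep: "\<And>J. J \<subseteq> K \<Longrightarrow> pos_lin_dependent_family J zbar \<Longrightarrow>
      \<forall>\<^sub>F k in F. lin_dependent_family J (z k)"
  obtains C where "C > 0" "\<forall>\<^sub>F k in F. \<forall>J\<subseteq>K. \<not> lin_dependent_family J (z k) \<longrightarrow>
    (\<forall>g. (\<forall>i\<in>J. 0 \<le> g i) \<longrightarrow> sum g J \<le> C * norm (\<Sum>i\<in>J. g i *\<^sub>R z k i))"
proof -
  have "\<exists>C>0. \<forall>\<^sub>F k in F. \<not> lin_dependent_family J (z k) \<longrightarrow>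
    (\<forall>g. (\<forall>i\<in>J. 0 \<le> g i) \<longrightarrow> sum g J \<le> C * norm (\<Sum>i\<in>J. g i *\<^sub>R z k i))" if J: "J \<in> Pow K" for J
  proof (cases "pos_lin_dependent_family J zbar")
    case True
    from dep[OF _ this] J show ?thesis
      by (intro exI[of _ 1]) (auto elim: eventually_mono)
  next
    case False
    have fJ: "finite J" using J K finite_subset by auto
    obtain c where c: "c > 0" "\<And>g :: 'i \<Rightarrow> real. (\<And>i. i \<in> J \<Longrightarrow> 0 \<le> g i) \<Longrightarrow> c * sum g J \<le> norm (\<Sum>i\<in>J. g i *\<^sub>R zbar i)"
      using not_pos_lin_dependent_bound[OF fJ False] by blast
    \<comment> \<open>Replacing \<open>zbar\<close> by \<open>z k\<close> costs at most half of the
      lower bound \<open>c\<close>, which leaves the constant \<open>2 / c\<close>.\<close>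
    have "\<forall>\<^sub>F k in F. \<forall>i\<in>J. dist (z k i) (zbar i) < c / 2"
      using fJ J c(1) by (intro eventually_ball_finite ballI tendstoD lim) auto
    then have "\<forall>\<^sub>F k in F. \<forall>g. (\<forall>i\<in>J. 0 \<le> g i) \<longrightarrow> sum g J \<le> (2 / c) * norm (\<Sum>i\<in>J. g i *\<^sub>R z k i)"
    proof eventually_elim
      case (elim k)
      show ?case
      proof clarify
        fix g assume g: "\<forall>i\<in>J. (0::real) \<le> g i"
        have "norm ((\<Sum>i\<in>J. g i *\<^sub>R z k i) - (\<Sum>i\<in>J. g i *\<^sub>R zbar i)) = norm (\<Sum>i\<in>J. g i *\<^sub>R (z k i - zbar i))"
          by (simp add: scaleR_diff_right sum_subtractf)
        also have "\<dots> \<le> (\<Sum>i\<in>J. g i * (c / 2))"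
        proof (intro sum_norm_le)
          fix i assume i: "i \<in> J"
          have "norm (g i *\<^sub>R (z k i - zbar i)) = g i * dist (z k i) (zbar i)"
            using g i by (simp add: dist_norm)
          then show "norm (g i *\<^sub>R (z k i - zbar i)) \<le> g i * (c / 2)"
            using mult_left_mono[of "dist (z k i) (zbar i)" "c / 2" "g i"] elim g i by force
        qed
        also have "\<dots> = (c / 2) * sum g J" by (simp add: sum_distrib_left mult.commute)
        finally have "norm (\<Sum>i\<in>J. g i *\<^sub>R zbar i) - norm (\<Sum>i\<in>J. g i *\<^sub>R z k i) \<le> (c / 2) * sum g J"
          by (smt (verit) norm_minus_commute norm_triangle_ineq2)
        moreover have "c * sum g J \<le> norm (\<Sum>i\<in>J. g i *\<^sub>R zbar i)" using c g by blast
        ultimately have "(c / 2) * sum g J \<le> norm (\<Sum>i\<in>J. g i *\<^sub>R z k i)" by (simp add: field_simps)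
        then show "sum g J \<le> (2 / c) * norm (\<Sum>i\<in>J. g i *\<^sub>R z k i)"
          using c(1) by (simp add: field_simps)
      qed
    qed
    then show ?thesis using c(1) by (intro exI[of _ "2 / c"]) (auto elim: eventually_mono)
  qed
  then have "\<exists>D. \<forall>J\<in>Pow K. D J > 0 \<and> (\<forall>\<^sub>F k in F. \<not> lin_dependent_family J (z k) \<longrightarrow>
    (\<forall>g. (\<forall>i\<in>J. 0 \<le> g i) \<longrightarrow> sum g J \<le> D J * norm (\<Sum>i\<in>J. g i *\<^sub>R z k i)))"
    by (intro bchoice ballI)
  then obtain D where D: "\<And>J. J \<in> Pow K \<Longrightarrow> D J > 0" "\<And>J. J \<in> Pow K \<Longrightarrow>
     \<forall>\<^sub>F k in F. \<not> lin_dependent_family J (z k) \<longrightarrow>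
    (\<forall>g. (\<forall>i\<in>J. 0 \<le> g i) \<longrightarrow> sum g J \<le> D J * norm (\<Sum>i\<in>J. g i *\<^sub>R z k i))"
    by blast
  have fin: "finite (Pow K)" using K by simp
  \<comment> \<open>There are finitely many subfamilies, and the sum of their positive constants
    dominates each of them.\<close>
  define C where "C = sum D (Pow K)"
  have DC: "D J \<le> C" if "J \<in> Pow K" for J
    unfolding C_def using fin that D(1) by (intro member_le_sum) (auto intro: less_imp_le)
  have "C > 0" using DC[of "{}"] D(1)[of "{}"] by simp
  moreover have "\<forall>\<^sub>F k in F. \<forall>J\<in>Pow K. \<not> lin_dependent_family J (z k) \<longrightarrow>
    (\<forall>g. (\<forall>i\<in>J. 0 \<le> g i) \<longrightarrow> sum g J \<le> D J * norm (\<Sum>i\<in>J. g i *\<^sub>R z k i))"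
    using fin D(2) by (intro eventually_ball_finite) auto
  then have "\<forall>\<^sub>F k in F. \<forall>J\<subseteq>K. \<not> lin_dependent_family J (z k) \<longrightarrow>
    (\<forall>g. (\<forall>i\<in>J. 0 \<le> g i) \<longrightarrow> sum g J \<le> C * norm (\<Sum>i\<in>J. g i *\<^sub>R z k i))"
  proof eventually_elim
    case (elim k)
    show ?case
    proof (intro allI impI)
      fix J g assume *: "J \<subseteq> K" "\<not> lin_dependent_family J (z k)" "\<forall>i\<in>J. (0::real) \<le> g i"
      then have "sum g J \<le> D J * norm (\<Sum>i\<in>J. g i *\<^sub>R z k i)" using elim by blast
      also have "\<dots> \<le> C * norm (\<Sum>i\<in>J. g i *\<^sub>R z k i)"
        using DC * by (intro mult_right_mono) auto
      finally show "sum g J \<le> C * norm (\<Sum>i\<in>J. g i *\<^sub>R z k i)" .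
    qed
  qed
  ultimately show ?thesis using that by blast
qed

subsection \<open>Penalised distance minimisation\<close>

text \<open>The mean value inequality on a ball where \<open>G'\<close> hardly varies. Both points
  are free, as required for base points \<open>x k\<close> that themselves move towards
  \<open>xbar\<close>.\<close>

lemma uniform_linearization:
  fixes G :: "'a::real_normed_vector \<Rightarrow> 'b::real_normed_vector" and G' :: "'a \<Rightarrow> 'a \<Rightarrow>\<^sub>L 'b"
  assumes deriv: "\<And>x. (G has_derivative blinfun_apply (G' x)) (at x)"
    and cont: "continuous_on UNIV G'" and "e > 0"
  obtains d where "d > 0" "\<And>x y. x \<in> ball xbar d \<Longrightarrow> y \<in> ball xbar d \<Longrightarrow>
    norm (G y - G x - G' x (y - x)) \<le> e * norm (y - x)"
proof -
  have "isCont G' xbar" using cont by (simp add: continuous_on_eq_continuous_at)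
  \<comment> \<open>Staying within \<open>e / 2\<close> of the value at the centre keeps any two
    values of \<open>G'\<close> in the ball within \<open>e\<close> of each other.\<close>
  then obtain d where d: "d > 0" "\<And>x. dist x xbar < d \<Longrightarrow> dist (G' x) (G' xbar) < e / 2"
    using \<open>e > 0\<close> unfolding continuous_at_eps_delta by (metis half_gt_zero)
  show ?thesis
  proof (rule that[OF d(1)])
    fix x y assume xy: "x \<in> ball xbar d" "y \<in> ball xbar d"
    have "norm (G y - G x - G' x (y - x)) \<le> norm (y - x) * e"
    proof (rule differentiable_bound_linearization[where S = "ball xbar d"])
      fix t :: real assume "t \<in> {0..1}"
      then show "x + t *\<^sub>R (y - x) \<in> ball xbar d"
        using xy convexD_alt[OF convex_ball, of x xbar d y t] by (simp add: algebra_simps)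
    next
      fix w assume "w \<in> ball xbar d"
      then have "dist (G' w) (G' x) \<le> e"
        using d(2)[of w] d(2)[of x] xy dist_triangle3[of "G' w" "G' x" "G' xbar"]
        by (smt (verit) dist_commute field_sum_of_halves mem_ball)
      then show "onorm (blinfun_apply (G' w) - blinfun_apply (G' x)) \<le> e"
        by (simp add: dist_norm norm_blinfun.rep_eq minus_blinfun.rep_eq fun_diff_def)
    qed (use xy deriv in \<open>auto intro: has_derivative_at_withinI\<close>)
    then show "norm (G y - G x - G' x (y - x)) \<le> e * norm (y - x)" by (simp add: mult.commute)
  qed
qed

text \<open>A nearest feasible point \<open>p\<close> has penalised value \<open>d\<^sup>2\<close>,
  which caps the distance of the minimiser from \<open>y\<close>. A large \<open>\<rho>\<close>
  makes every point of the half-size ball more expensive than that, which gives the lower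
  bound.\<close>

lemma penalty_minimizer:
  fixes G :: "'a::euclidean_space \<Rightarrow> 'b::metric_space"
  assumes G: "continuous_on UNIV G" and C: "closed C" and z: "G z \<in> C"
    and d: "d = infdist y {x. G x \<in> C}" "d > 0"
  obtains \<rho> x where "\<rho> > 0" "d / 2 < dist x y" "dist x y \<le> d"
    "\<And>w. w \<in> ball y (d + 1) \<Longrightarrow>
      (dist x y)\<^sup>2 + \<rho> * (infdist (G x) C)\<^sup>2 \<le> (dist w y)\<^sup>2 + \<rho> * (infdist (G w) C)\<^sup>2"
proof -
  define F where "F = {x. G x \<in> C}"
  have "F = G -` C" by (auto simp: F_def)
  then have F: "closed F" "F \<noteq> {}"
    using z C G by (auto simp: F_def intro!: continuous_closed_vimage simp: continuous_on_eq_continuous_at)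
  have "C \<noteq> {}" using z by auto
  obtain p where p: "p \<in> F" "d = dist y p"
    using infdist_attains_inf[OF F, of y] d by (auto simp: F_def)
  define h where "h x = (infdist (G x) C)\<^sup>2" for x
  have hcont: "continuous_on A h" for A
    unfolding h_def using G by (intro continuous_intros) (auto intro: continuous_on_subset)
  \<comment> \<open>\<open>q\<close> attains the least infeasibility on the half-size ball; it is
    positive because no feasible point is closer to \<open>y\<close> than \<open>d\<close>.\<close>
  have "\<exists>x\<in>cball y (d / 2). \<forall>w\<in>cball y (d / 2). h x \<le> h w"
    using d hcont by (intro continuous_attains_inf) auto
  then obtain q where q: "q \<in> cball y (d / 2)" "\<And>w. w \<in> cball y (d / 2) \<Longrightarrow> h q \<le> h w" by blast
  have "q \<notin> F" using q(1) d infdist_le[of q F y] by (auto simp: F_def)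
  then have "h q > 0"
    using infdist_pos_not_in_closed[OF C \<open>C \<noteq> {}\<close>, of "G q"] by (simp add: F_def h_def)
  \<comment> \<open>Chosen so that \<open>\<rho> * h q = d\<^sup>2 + 1\<close>, just above the value
    at \<open>p\<close>.\<close>
  define \<rho> where "\<rho> = (d\<^sup>2 + 1) / h q"
  have "\<rho> > 0" using \<open>h q > 0\<close> by (simp add: \<rho>_def add_nonneg_pos)
  define f where "f x = (dist x y)\<^sup>2 + \<rho> * h x" for x
  \<comment> \<open>The radius exceeds \<open>d\<close>, so the minimiser, found within distance
    \<open>d\<close>, lies in the interior and stationarity will apply there.\<close>
  have "\<exists>x\<in>cball y (d + 1). \<forall>w\<in>cball y (d + 1). f x \<le> f w"
    using d hcont unfolding f_def by (intro continuous_attains_inf continuous_intros) auto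
  then obtain x where x: "x \<in> cball y (d + 1)" "\<And>w. w \<in> cball y (d + 1) \<Longrightarrow> f x \<le> f w" by blast
  have "f x \<le> f p" using p d by (intro x) auto
  also have "f p = d\<^sup>2" using p C \<open>C \<noteq> {}\<close> by (simp add: f_def F_def h_def dist_commute)
  finally have fx: "(dist x y)\<^sup>2 + \<rho> * h x \<le> d\<^sup>2" by (simp add: f_def)
  have "h x \<ge> 0" by (simp add: h_def)
  then have "(dist x y)\<^sup>2 \<le> d\<^sup>2" using fx \<open>\<rho> > 0\<close> by (smt (verit) mult_nonneg_nonneg)
  then have "dist x y \<le> d" using d by (simp add: power2_le_iff_abs_le)
  moreover have "d / 2 < dist x y"
  proof (rule ccontr)
    assume "\<not> d / 2 < dist x y"
    then have "h q \<le> h x" by (intro q) (simp add: dist_commute)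
    then have "\<rho> * h q \<le> \<rho> * h x" using \<open>\<rho> > 0\<close> by simp
    moreover have "\<rho> * h q = d\<^sup>2 + 1" using \<open>h q > 0\<close> by (simp add: \<rho>_def)
    ultimately show False using fx zero_le_power2[of "dist x y"] by linarith
  qed
  moreover have "(dist x y)\<^sup>2 + \<rho> * (infdist (G x) C)\<^sup>2 \<le> (dist w y)\<^sup>2 + \<rho> * (infdist (G w) C)\<^sup>2"
    if "w \<in> ball y (d + 1)" for w
    using x(2)[of w] that by (simp add: f_def h_def)
  ultimately show ?thesis using that \<open>\<rho> > 0\<close> by blast
qed

text \<open>
  The squared distance to \<open>C\<close> need not be differentiated: it is majorised by the squared distance
  to the fixed point \<open>G x + P\<close> of \<open>C\<close>, with equality at the minimiser \<open>x\<close>.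
\<close>

lemma penalty_stationarity:
  fixes G :: "'a::real_inner \<Rightarrow> 'b::real_inner"
  assumes G: "(G has_derivative G') (at x)" and "\<rho> > 0"
    and min: "\<And>w. w \<in> U \<Longrightarrow>
      (dist x y)\<^sup>2 + \<rho> * (infdist (G x) C)\<^sup>2 \<le> (dist w y)\<^sup>2 + \<rho> * (infdist (G w) C)\<^sup>2"
    and U: "open U" "x \<in> U"
    and P: "G x + P \<in> C" "\<And>S. S \<in> C \<Longrightarrow> norm P \<le> dist (G x) S"
  shows "(x - y) \<bullet> H = \<rho> * (P \<bullet> G' H)"
proof -
  define Q where "Q = G x + P"
  define f where "f w = (w - y) \<bullet> (w - y) + \<rho> * ((G w - Q) \<bullet> (G w - Q))" for w
  have f: "f w = (dist w y)\<^sup>2 + \<rho> * (dist (G w) Q)\<^sup>2" for w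
    by (simp add: f_def dist_norm dot_square_norm)
  have "norm P \<le> infdist (G x) C"
    using P by (auto simp: infdist_def intro!: cINF_greatest)
  have "f x \<le> f w" if "w \<in> U" for w
  proof -
    have "dist (G x) Q = norm P" by (simp add: Q_def dist_norm)
    then have "f x \<le> (dist x y)\<^sup>2 + \<rho> * (infdist (G x) C)\<^sup>2"
      using \<open>norm P \<le> _\<close> \<open>\<rho> > 0\<close> by (simp add: f power_mono)
    also have "\<dots> \<le> (dist w y)\<^sup>2 + \<rho> * (infdist (G w) C)\<^sup>2" by (rule min[OF that])
    also have "\<dots> \<le> f w"
      using P(1) \<open>\<rho> > 0\<close> by (simp add: f Q_def infdist_le infdist_nonneg power_mono)
    finally show ?thesis .
  qed
  moreover have "(f has_derivative (\<lambda>h. 2 * ((x - y) \<bullet> h) + \<rho> * (2 * ((G x - Q) \<bullet> G' h)))) (at x)"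
    unfolding f_def by (auto intro!: derivative_eq_intros G simp: inner_commute algebra_simps)
  ultimately have "(\<lambda>h. 2 * ((x - y) \<bullet> h) + \<rho> * (2 * ((G x - Q) \<bullet> G' h))) = (\<lambda>h. 0)"
    using U by (intro differential_zero_maxmin[of x U f]) auto
  from fun_cong[OF this, of H] show ?thesis by (simp add: Q_def)
qed

section \<open>The vectors \<open>v_diag\<close> in terms of the derivative of
  \<open>G\<close>\<close>

lemma partial_deriv_eq:
  fixes G :: "real^'n \<Rightarrow> real^'m^'m"
  assumes "(G has_derivative G') (at x)"
  shows "partial_deriv G i x = G' (axis i 1)"
proof -
  interpret G': bounded_linear G' using assms by (rule has_derivative_bounded_linear)
  have "((\<lambda>t. x + t *\<^sub>R axis i 1) has_derivative (\<lambda>t. t *\<^sub>R axis i 1)) (at 0)"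
    by (auto intro!: derivative_eq_intros)
  from has_derivative_compose[OF this] assms
  have "((\<lambda>t. G (x + t *\<^sub>R axis i 1)) has_derivative (\<lambda>t. G' (t *\<^sub>R axis i 1))) (at 0)" by simp
  then show ?thesis unfolding partial_deriv_def
    by (intro vector_derivative_at) (simp add: has_vector_derivative_def G'.scaleR)
qed

text \<open>\<open>v_diag G x E i\<close> is the adjoint of the derivative applied to
  \<open>outer (E i)\<close>; this turns stationarity into a combination of these vectors.\<close>

lemma v_diag_inner:
  fixes G :: "real^'n \<Rightarrow> real^'m^'m"
  assumes G: "(G has_derivative G') (at x)"
  shows "v_diag G x E i \<bullet> H = outer (E i) \<bullet> G' H"
proof -
  interpret G': bounded_linear G' using G by (rule has_derivative_bounded_linear)
  have "H = (\<Sum>j\<in>UNIV. H $ j *\<^sub>R axis j 1)"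
    using basis_expansion[of H] by (simp add: scalar_mult_eq_scaleR)
  then have "G' H = (\<Sum>j\<in>UNIV. H $ j *\<^sub>R G' (axis j 1))"
    by (metis (no_types, lifting) G'.scaleR G'.sum sum.cong)
  then have "outer (E i) \<bullet> G' H = (\<Sum>j\<in>UNIV. H $ j * (outer (E i) \<bullet> G' (axis j 1)))"
    by (simp add: inner_sum_right)
  then show ?thesis
    by (simp add: v_diag_def inner_vec_def[of "vec_lambda _"] partial_deriv_eq[OF G] inner_outer mult.commute)
qed

lemma tendsto_v_diag:
  fixes G :: "real^'n \<Rightarrow> real^'m^'m"
  assumes deriv: "\<And>x. (G has_derivative blinfun_apply (G' x)) (at x)"
    and cont: "continuous_on UNIV G'"
    and x: "(x \<longlongrightarrow> xbar) F" and E: "((\<lambda>k. E k i) \<longlongrightarrow> Ebar i) F"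
  shows "((\<lambda>k. v_diag G (x k) (E k) i) \<longlongrightarrow> v_diag G xbar Ebar i) F"
proof -
  have "((\<lambda>k. G' (x k)) \<longlongrightarrow> G' xbar) F"
    using x cont by (metis UNIV_I continuous_on_eq_continuous_at isCont_tendsto_compose open_UNIV)
  then have pd: "((\<lambda>k. partial_deriv G j (x k)) \<longlongrightarrow> partial_deriv G j xbar) F" for j
    unfolding partial_deriv_eq[OF deriv] by (intro tendsto_intros)
  show ?thesis
    unfolding v_diag_def inner_outer[symmetric] outer_def
    by (intro tendsto_vec_lambda tendsto_inner tendsto_mult tendsto_vec_nth E pd)
qed

text \<open>
  The multiplier at the penalty minimiser lives on the eigenvectors of the negative eigenvalues, so
  after the reduction to an independent subfamily its pairing with \<open>G x\<close> is still nonpositive.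
\<close>

lemma penalty_minimizer_estimate:
  fixes G :: "real^'n \<Rightarrow> real^'m^'m"
  assumes sym: "G x \<in> symmetric_matrices" and G': "(G has_derivative G') (at x)"
    and E: "E \<in> eigvec_matrices r (G x)"
    and compl: "\<And>w. (\<And>i. i \<in> {1..CARD('m) - r} \<Longrightarrow> E i \<bullet> w = 0) \<Longrightarrow> 0 \<le> w \<bullet> (G x *v w)"
    and \<rho>: "\<rho> > 0" and min: "\<And>w. w \<in> U \<Longrightarrow> (dist x y)\<^sup>2 + \<rho> * (infdist (G x) psd_cone)\<^sup>2
      \<le> (dist w y)\<^sup>2 + \<rho> * (infdist (G w) psd_cone)\<^sup>2"
    and U: "open U" "x \<in> U"
    and C: "C > 0" and bound: "\<And>J g. J \<subseteq> {1..CARD('m) - r} \<Longrightarrow>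
      \<not> lin_dependent_family J (v_diag G x E) \<Longrightarrow> (\<And>i. i \<in> J \<Longrightarrow> 0 \<le> g i) \<Longrightarrow>
      sum g J \<le> C * norm (\<Sum>i\<in>J. g i *\<^sub>R v_diag G x E i)"
    and lin: "norm (G y - G x - G' (y - x)) \<le> 1 / (2 * C) * norm (y - x)"
  shows "dist x y \<le> 2 * C * norm (proj_psd (- G y))"
proof -
  interpret G': bounded_linear G' using G' by (rule has_derivative_bounded_linear)
  define K where "K = {1..CARD('m) - r}"
  define v where "v = v_diag G x E"
  define a where "a i = max 0 (- eigval (r + i) (G x))" for i
  define P where "P = (\<Sum>i\<in>K. a i *\<^sub>R outer (E i))"
  have vH: "v i \<bullet> H = outer (E i) \<bullet> G' H" for i H
    unfolding v_def by (rule v_diag_inner[OF G'])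
  have "(x - y) \<bullet> H = (\<Sum>i\<in>K. (\<rho> * a i) *\<^sub>R v i) \<bullet> H" for H
  proof -
    have "(x - y) \<bullet> H = \<rho> * (P \<bullet> G' H)"
      using closest_psd_point[OF sym E compl] unfolding P_def a_def K_def
      by (intro penalty_stationarity[OF G' \<rho> min U]) auto
    also have "\<dots> = (\<Sum>i\<in>K. (\<rho> * a i) *\<^sub>R v i) \<bullet> H"
      by (simp add: P_def inner_sum_left vH sum_distrib_left mult.assoc)
    finally show ?thesis .
  qed
  then have stat: "x - y = (\<Sum>i\<in>K. (\<rho> * a i) *\<^sub>R v i)"
    by (metis vector_eq_rdot)
  obtain J c where J: "J \<subseteq> {i\<in>K. 0 < \<rho> * a i}" "\<And>i. i \<in> J \<Longrightarrow> 0 < c i"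
    "\<not> lin_dependent_family J v" "(\<Sum>i\<in>J. c i *\<^sub>R v i) = x - y"
    using conic_caratheodory[of K "\<lambda>i. \<rho> * a i" v] \<rho> stat by (auto simp: K_def a_def)
  define n where "n = norm (x - y)"
  define p where "p = norm (proj_psd (- G y))"
  define R where "R = G y - G x - G' (y - x)"
  have R: "norm R \<le> n / (2 * C)" using lin by (simp add: R_def n_def norm_minus_commute)
  \<comment> \<open>Independence of the subfamily makes \<open>bound\<close> applicable. The
    combination equals \<open>x - y\<close>, so the multipliers are controlled independently of the
    size of \<open>\<rho>\<close>.\<close>
  have sumc: "sum c J \<le> C * n"
    unfolding n_def J(4)[symmetric] v_def
    using J by (intro bound) (auto simp: v_def K_def intro: less_imp_le)
  \<comment> \<open>Linearising splits the pairing into three: \<open>G x\<close> contributes a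
    negative eigenvalue, \<open>- G y\<close> is bounded through its projection, and
    \<open>R\<close> is the remainder.\<close>
  have "v i \<bullet> (x - y) \<le> p + n / (2 * C)" if "i \<in> J" for i
  proof -
    have i: "i \<in> K" "a i > 0" using J(1) that \<rho> by (auto simp: zero_less_mult_iff)
    have nE: "norm (outer (E i)) = 1"
      using eigvec_matrices_norm[OF E] i by (simp add: norm_outer K_def)
    have "G' (x - y) = G x + (- G y) + R" by (simp add: R_def G'.diff)
    then have "v i \<bullet> (x - y) = outer (E i) \<bullet> G x + outer (E i) \<bullet> (- G y) + outer (E i) \<bullet> R"
      by (simp only: vH inner_add_right)
    moreover have "outer (E i) \<bullet> G x \<le> 0"
      using eigvec_matrices_quadratic_form[OF E] i by (simp add: K_def inner_outer a_def max_def split: if_splits)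
    moreover have "outer (E i) \<bullet> (- G y) \<le> outer (E i) \<bullet> proj_psd (- G y)"
      by (rule inner_le_inner_proj_psd[OF outer_psd])
    moreover have "outer (E i) \<bullet> proj_psd (- G y) \<le> p" "outer (E i) \<bullet> R \<le> norm R"
      using norm_cauchy_schwarz[of "outer (E i)"] nE by (auto simp: p_def)
    ultimately show ?thesis using R by linarith
  qed
  then have "(\<Sum>i\<in>J. c i * (v i \<bullet> (x - y))) \<le> (\<Sum>i\<in>J. c i * (p + n / (2 * C)))"
    using J(2) by (intro sum_mono mult_left_mono) (auto intro: less_imp_le)
  moreover have "n * n = (\<Sum>i\<in>J. c i * (v i \<bullet> (x - y)))"
    using J(4) by (metis (no_types, lifting) dot_square_norm inner_scaleR_left inner_sum_left n_def power2_eq_square sum.cong)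
  ultimately have "n * n \<le> sum c J * (p + n / (2 * C))"
    by (simp add: sum_distrib_right)
  \<comment> \<open>The remainder contributes \<open>n * n / 2\<close>, by the choice of the
    tolerance \<open>1 / (2 * C)\<close> in \<open>lin\<close>; after cancelling \<open>n\<close>
    this half is absorbed on the left.\<close>
  also have "\<dots> \<le> C * n * (p + n / (2 * C))"
    using sumc C by (intro mult_right_mono) (auto simp: p_def n_def)
  also have "\<dots> = n * (C * p + n / 2)" using C by (simp add: field_simps)
  finally have "n \<le> C * p + n / 2"
    by (cases "n = 0") (use C in \<open>auto simp: n_def p_def\<close>)
  then show ?thesis by (simp add: dist_norm n_def p_def)
qed

section \<open>Contradiction along a sequence of penalty minimisers\<close>

theorem theorem5p1:
  fixes G :: "real^'n \<Rightarrow> real^'m^'m" and xbar :: "real^'n"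
  assumes "range G \<subseteq> symmetric_matrices"
    and "continuously_differentiable G"
    and "xbar \<in> feasible_set G"
    and "seq_CPLD G xbar"
    and "twice_differentiable_around G xbar"
  shows "metric_subregularity_CQ G xbar"
proof (rule ccontr)
  assume neg: "\<not> metric_subregularity_CQ G xbar"
  have sym: "G x \<in> symmetric_matrices" for x using assms(1) by auto
  obtain G' :: "real^'n \<Rightarrow> (real^'n) \<Rightarrow>\<^sub>L (real^'m^'m)"
    where deriv: "\<And>x. (G has_derivative blinfun_apply (G' x)) (at x)" and G'c: "continuous_on UNIV G'"
    using assms(2) by (auto simp: continuously_differentiable_def)
  have Gc: "continuous_on UNIV G"
    using has_derivative_continuous[OF deriv] by (simp add: continuous_on_eq_continuous_at)
  have xbar: "G xbar \<in> psd_cone" using assms(3) by (simp add: feasible_set_def)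
  define r where "r = rank (G xbar)"
  have r: "r \<le> CARD('m)" using rank_bound[of "G xbar"] by (simp add: r_def)
  \<comment> \<open>The failing constants are \<open>k + 1\<close> and the failing neighbourhoods
    are balls of radius \<open>1 / (k + 1)\<close>.\<close>
  have "\<exists>y. dist y xbar < 1 / real (Suc k) \<and>
      real (Suc k) * norm (proj_psd (- G y)) < infdist y (feasible_set G)" for k
    using neg unfolding metric_subregularity_CQ_def
    by (auto dest!: spec[of _ "real (Suc k)"] spec[of _ "ball xbar (1 / real (Suc k))"]
        simp: not_le dist_commute)
  then obtain y where y: "\<And>k. dist (y k) xbar < 1 / real (Suc k)"
    "\<And>k. real (Suc k) * norm (proj_psd (- G (y k))) < infdist (y k) (feasible_set G)"
    by metis
  define d where "d k = infdist (y k) (feasible_set G)" for k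
  have d0: "d k > 0" for k
    using y(2)[of k] unfolding d_def by (smt (verit) mult_nonneg_nonneg norm_ge_zero of_nat_0_le_iff)
  have dy: "d k \<le> dist (y k) xbar" for k unfolding d_def using assms(3) by (rule infdist_le)
  have "\<exists>\<rho> x. \<rho> > 0 \<and> d k / 2 < dist x (y k) \<and> dist x (y k) \<le> d k \<and>
    (\<forall>w\<in>ball (y k) (d k + 1). (dist x (y k))\<^sup>2 + \<rho> * (infdist (G x) psd_cone)\<^sup>2
      \<le> (dist w (y k))\<^sup>2 + \<rho> * (infdist (G w) psd_cone)\<^sup>2)" for k
    using penalty_minimizer[OF Gc closed_psd_cone xbar _ d0[of k], of "y k"]
    unfolding d_def feasible_set_def by (metis (no_types, lifting))
  then obtain \<rho> x where x: "\<And>k. \<rho> k > 0" "\<And>k. d k / 2 < dist (x k) (y k)" "\<And>k. dist (x k) (y k) \<le> d k"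
    and xmin: "\<And>k w. w \<in> ball (y k) (d k + 1) \<Longrightarrow> (dist (x k) (y k))\<^sup>2 + \<rho> k * (infdist (G (x k)) psd_cone)\<^sup>2
      \<le> (dist w (y k))\<^sup>2 + \<rho> k * (infdist (G w) psd_cone)\<^sup>2"
    by metis
  have ylim: "y \<longlonglongrightarrow> xbar"
  proof (rule metric_tendsto_imp_tendsto)
    show "(\<lambda>k. 1 / real (Suc k)) \<longlonglongrightarrow> 0" using LIMSEQ_inverse_real_of_nat by (simp add: inverse_eq_divide)
  qed (use y in \<open>auto intro!: always_eventually less_imp_le simp del: of_nat_Suc\<close>)
  have xlim: "x \<longlonglongrightarrow> xbar"
  proof (rule metric_tendsto_imp_tendsto)
    \<comment> \<open>The factor 2 comes from
      \<open>dist (x k) (y k) \<le> d k \<le> dist (y k) xbar\<close> and the triangle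
      inequality.\<close>
    show "(\<lambda>k. 2 * dist (y k) xbar) \<longlonglongrightarrow> 0" 
      using tendsto_dist_iff[THEN iffD1, OF ylim] by (rule tendsto_mult_right_zero)
    show "\<forall>\<^sub>F k in sequentially. dist (x k) xbar \<le> dist (2 * dist (y k) xbar) 0"
    proof (intro always_eventually allI)
      fix k show "dist (x k) xbar \<le> dist (2 * dist (y k) xbar) 0"
        using x(3)[of k] dy[of k] dist_triangle[of "x k" xbar "y k"] by simp
    qed
  qed
  obtain I E Ebar where I: "infinite I"
    and E: "\<And>k. k \<in> I \<Longrightarrow> E k \<in> eigvec_matrices r (G (x k))"
    and Elim: "\<And>i. i \<in> {1..CARD('m) - r} \<Longrightarrow>
      ((\<lambda>k. E k i) \<longlongrightarrow> Ebar i) (inf sequentially (principal I))"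
    and dep: "\<And>J. J \<subseteq> {1..CARD('m) - r} \<Longrightarrow> pos_lin_dependent_family J (v_diag G xbar Ebar) \<Longrightarrow>
      \<forall>\<^sub>F k in inf sequentially (principal I). lin_dependent_family J (v_diag G (x k) (E k))"
  \<comment> \<open>At full rank the index set is empty: arbitrary columns, here zero, qualify, and
    the empty family is never positively linearly dependent. Both alternatives of seq-CPLD thus
    continue in the same way.\<close>
  proof (cases "r = CARD('m)")
    case True
    show ?thesis
      by (rule that[of UNIV "\<lambda>_ _. 0" "\<lambda>_. 0"])
         (auto simp: True eigvec_matrices_def pos_lin_dependent_family_def)
  next
    case False
    have "x \<longlonglongrightarrow> xbar \<and> range (\<lambda>_::nat. 0::real^'m^'m) \<subseteq> symmetric_matrices \<and> (\<lambda>_::nat. 0::real^'m^'m) \<longlonglongrightarrow> 0"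
      using xlim zero_in_psd_cone by (auto simp: psd_cone_def)
    then have "\<exists>I E Ebar. infinite I \<and> (\<forall>k\<in>I. E k \<in> eigvec_matrices r (G (x k) + 0)) \<and>
        (\<forall>i\<in>{1..CARD('m) - r}. ((\<lambda>k. E k i) \<longlongrightarrow> Ebar i) (inf sequentially (principal I))) \<and>
        (\<forall>J\<subseteq>{1..CARD('m) - r}. pos_lin_dependent_family J (v_diag G xbar Ebar) \<longrightarrow>
          (\<forall>\<^sub>F k in inf sequentially (principal I). lin_dependent_family J (v_diag G (x k) (E k))))"
      using assms(4) False unfolding seq_CPLD_def Let_def r_def[symmetric] by blast
    then show ?thesis using that unfolding add_0_right by blast
  qed
  define F where "F = inf sequentially (principal I)"
  have Fseq: "F \<le> sequentially" by (simp add: F_def)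
  \<comment> \<open>Infinity of \<open>I\<close> makes the filter proper, so deriving
    \<open>False\<close> eventually along \<open>F\<close> is a contradiction.\<close>
  have "F \<noteq> bot"
    using I by (auto simp: F_def trivial_limit_def eventually_inf_principal eventually_sequentially infinite_nat_iff_unbounded_le)
  obtain C where C: "C > 0" and bound: "\<forall>\<^sub>F k in F. \<forall>J\<subseteq>{1..CARD('m) - r}.
      \<not> lin_dependent_family J (v_diag G (x k) (E k)) \<longrightarrow> (\<forall>g. (\<forall>i\<in>J. 0 \<le> g i) \<longrightarrow>
      sum g J \<le> C * norm (\<Sum>i\<in>J. g i *\<^sub>R v_diag G (x k) (E k) i))"
  proof (rule eventually_coefficients_bounded)
    show "((\<lambda>k. v_diag G (x k) (E k) i) \<longlongrightarrow> v_diag G xbar Ebar i) F" if "i \<in> {1..CARD('m) - r}" for i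
      using deriv G'c tendsto_mono[OF Fseq xlim] Elim[OF that, folded F_def] by (rule tendsto_v_diag)
  qed (use dep F_def in auto)
  obtain S c where S: "subspace S" "dim S = r" "c > 0" "\<And>v. v \<in> S \<Longrightarrow> c * (v \<bullet> v) \<le> v \<bullet> (G xbar *v v)"
    using psd_positive_on_rank_subspace[OF xbar] unfolding r_def by blast
  \<comment> \<open>The tolerance depends on \<open>C\<close>, so the multiplier bound has to be
    fixed before the radius.\<close>
  obtain \<delta> where \<delta>: "\<delta> > 0" "\<And>x y. x \<in> ball xbar \<delta> \<Longrightarrow> y \<in> ball xbar \<delta> \<Longrightarrow>
      norm (G y - G x - G' x (y - x)) \<le> 1 / (2 * C) * norm (y - x)"
    using uniform_linearization[OF deriv G'c, of "1 / (2 * C)"] C by auto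
  have "(\<lambda>k. G (x k)) \<longlonglongrightarrow> G xbar"
    using xlim Gc by (metis UNIV_I continuous_on_eq_continuous_at isCont_tendsto_compose open_UNIV)
  then have "\<forall>\<^sub>F k in sequentially. dist (G (x k)) (G xbar) < c" using S(3) by (rule tendstoD)
  moreover have "\<forall>\<^sub>F k in sequentially. dist (x k) xbar < \<delta>" "\<forall>\<^sub>F k in sequentially. dist (y k) xbar < \<delta>"
    using xlim ylim \<delta>(1) by (auto intro: tendstoD)
  moreover have "\<forall>\<^sub>F k in sequentially. 4 * C \<le> real (Suc k)"
    using filterlim_real_sequentially[unfolded filterlim_at_top, rule_format, of "4 * C"]
    by (auto elim: eventually_mono)
  ultimately have "\<forall>\<^sub>F k in sequentially. dist (G (x k)) (G xbar) < c \<and> dist (x k) xbar < \<delta> \<and>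
      dist (y k) xbar < \<delta> \<and> 4 * C \<le> real (Suc k)"
    by eventually_elim auto
  then have "\<forall>\<^sub>F k in F. dist (G (x k)) (G xbar) < c \<and> dist (x k) xbar < \<delta> \<and>
      dist (y k) xbar < \<delta> \<and> 4 * C \<le> real (Suc k)"
    using Fseq by (rule filter_leD[rotated])
  moreover have "\<forall>\<^sub>F k in F. k \<in> I" by (simp add: F_def eventually_inf_principal)
  ultimately have "\<forall>\<^sub>F k in F. False"
    using bound
  proof eventually_elim
    case (elim k)
    \<comment> \<open>The perturbation \<open>G (x k) - G xbar\<close> has norm below
      \<open>c\<close> and cannot destroy the uniform positivity on \<open>S\<close>.\<close>
    have "0 < v \<bullet> (G (x k) *v v)" if "v \<in> S" "v \<noteq> 0" for v
    proof -
      have "\<bar>v \<bullet> ((G (x k) - G xbar) *v v)\<bar> \<le> dist (G (x k)) (G xbar) * (norm v)\<^sup>2"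
        unfolding dist_norm by (rule abs_quadratic_form_le)
      also have "\<dots> < c * (norm v)\<^sup>2" using elim that by simp
      finally show ?thesis
        using S(4)[OF that(1)] by (simp add: matrix_vector_mult_diff_rdistrib inner_diff_right dot_square_norm)
    qed
    then have compl: "0 \<le> w \<bullet> (G (x k) *v w)"
      if "\<And>i. i \<in> {1..CARD('m) - r} \<Longrightarrow> E k i \<bullet> w = 0" for w
      using quadratic_form_nonneg_on_eigvec_complement[OF sym E r S(1,2) _ that] elim by blast
    have "x k \<in> ball (y k) (d k + 1)" using x(3)[of k] by (simp add: dist_commute)
    moreover have "norm (G (y k) - G (x k) - G' (x k) (y k - x k)) \<le> 1 / (2 * C) * norm (y k - x k)"
      using elim by (intro \<delta>) (auto simp: dist_commute)
    ultimately have "dist (x k) (y k) \<le> 2 * C * norm (proj_psd (- G (y k)))"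
      using elim C by (intro penalty_minimizer_estimate[OF sym deriv E compl x(1) xmin open_ball]) auto
    \<comment> \<open>Since \<open>dist (x k) (y k)\<close> exceeds \<open>d k / 2\<close>, the
      estimate doubles to the constant \<open>4 * C\<close>, which \<open>k + 1\<close> eventually
      overtakes.\<close>
    then have "d k < 4 * C * norm (proj_psd (- G (y k)))" using x(2)[of k] by simp
    also have "\<dots> \<le> real (Suc k) * norm (proj_psd (- G (y k)))"
      using elim by (intro mult_right_mono) auto
    finally show False using y(2)[of k] by (simp add: d_def)
  qed
  then show False using \<open>F \<noteq> bot\<close> by (simp add: trivial_limit_def)
qed

end
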